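(* Let $G$ and $H$ be finitely generated groups, let $T$ be a generating set of $H$, let $\mathcal{Q}$ be a finite collection of subgroups of $H$ such that $\mathcal{Q}\hookrightarrow_h (H,T)$, and let $q\colon G\to H$ be a quasi-isometry. Suppose that (1) $\mathcal{Q}$ is a qi-characteristic collection of subgroups of $H$, and (2) $S\subset G$ is a generating set such that $q\colon\Gamma(G,S)\to\Gamma(H,T)$ is a quasi-isometry. Then there is a finite collection $\mathcal{P}$ of subgroups of $G$ such that $\mathcal{P}\hookrightarrow_h (G,S)$ and $q\colon(G,\mathcal{P})\to(H,\mathcal{Q})$ is a quasi-isometry of pairs.
   Context: Finitely generated groups carry word metrics from chosen finite generating sets; generating sets $S,T$ may be infinite. $\Gamma(G,S)$ is the Cayley graph, with vertex set $G$ and edges $\{g,gs\}$ ($g\in G$, $s\in S$); a map $q\colon G\to H$ is called a quasi-isometry $\Gamma(G,S)\to\Gamma(H,T)$ if it is a quasi-isometry for the word metrics $\mathrm{dist}_{(G,S)}$, $\mathrm{dist}_{(H,T)}$. For a collection $\mathcal{P}$ of subgroups of $G$, $G/\mathcal{P}$ denotes the set of all left cosets $gP$ with $g\in G$, $P\in\mathcal{P}$. Quasi-isometry of pairs: an $(L,C)$-quasi-isometry $q\colon G\to H$ of finitely generated groups is an $(L,C,M)$-quasi-isometry of pairs $q\colon(G,\mathcal{P})\to(H,\mathcal{Q})$ if the relation $\dot q=\{(A,B)\in G/\mathcal{P}\times H/\mathcal{Q} : \mathrm{hdist}_H(q(A),B)<M\}$ has surjective projections to $G/\mathcal{P}$ and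 to $H/\mathcal{Q}$, where $\mathrm{hdist}_H$ is Hausdorff distance in $H$ for the finite-generating-set word metric. It is a quasi-isometry of pairs if this holds for some $L,C,M$. The commensurator of $P\le G$ is $\mathrm{Comm}_G(P)=\{g\in G : P\cap gPg^{-1}$ has finite index in both $P$ and $gPg^{-1}\}$. A collection $\mathcal{P}$ of subgroups of a finitely generated group $G$ is qi-characteristic if $\mathcal{P}$ is finite; each $P\in\mathcal{P}$ has finite index in $\mathrm{Comm}_G(P)$; and for every $L\ge1$, $C\ge0$ there is $M=M(G,\mathcal{P},L,C)\ge0$ such that every $(L,C)$-quasi-isometry $G\to G$ is an $(L,C,M)$-quasi-isometry of pairs $(G,\mathcal{P})\to(G,\mathcal{P})$. Hyperbolically embedded: for $S\subset G$, the coned-off Cayley graph $\hat\Gamma(G,\mathcal{P},S)$ has vertex set $G\cup G/\mathcal{P}$ and edges $\{g,gs\}$ for $g\in G$, $s\in S$, and $\{x,gP\}$ for $g\in G$, $P\in\mathcal{P}$, $x\in gP$. Vertices $gP$ are cone vertices. A graph $\Gamma$ is fine at a vertex $v$ if the set $T_v\Gamma$ of vertices adjacent to $v$, with the metric $\angle_v(x,y)$ = length of a shortest path from $x$ to $y$ in $\Gamma\setminus\{v\}$ ($\infty$ if none), is locally finite (balls of finite radius are finite). $\mathcal{P}\hookrightarrow_h(G,S)$ means that $\hat\Gamma(G,\mathcal{P},S)$ is a connected (Gromov) hyperbolic graph that is fine at every cone vertex. *)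

theory Defs
  imports "HOL-Algebra.Generated_Groups" "HOL-Algebra.Left_Coset" "HOL-Library.Extended_Real"
begin

section \<open>Graphs\<close>

record 'v ugraph =
  verts :: "'v set"
  edges :: "'v set set"

definition walk :: "'v ugraph \<Rightarrow> 'v \<Rightarrow> 'v list \<Rightarrow> 'v \<Rightarrow> bool" where
  "walk \<Gamma> u p v \<longleftrightarrow>
     p \<noteq> [] \<and> hd p = u \<and> last p = v \<and> set p \<subseteq> verts \<Gamma> \<and>
     successively (\<lambda>x y. {x, y} \<in> edges \<Gamma>) p"

text \<open>The value is \<open>\<infinity>\<close> if there is no walk, as the infimum of the empty set.\<close>

definition graph_dist :: "'v ugraph \<Rightarrow> 'v \<Rightarrow> 'v \<Rightarrow> enat" where
  "graph_dist \<Gamma> u v = (INF p \<in> {p. walk \<Gamma> u p v}. enat (length p - 1))"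

definition connected_graph :: "'v ugraph \<Rightarrow> bool" where
  "connected_graph \<Gamma> \<longleftrightarrow> (\<forall>u\<in>verts \<Gamma>. \<forall>v\<in>verts \<Gamma>. \<exists>p. walk \<Gamma> u p v)"

definition geodesic :: "'v ugraph \<Rightarrow> 'v \<Rightarrow> 'v list \<Rightarrow> 'v \<Rightarrow> bool" where
  "geodesic \<Gamma> u p v \<longleftrightarrow> walk \<Gamma> u p v \<and> enat (length p - 1) = graph_dist \<Gamma> u v"

text \<open>Gromov hyperbolicity by slim geodesic triangles (Rips condition). The corners are vertices
  and the sides are geodesic edge paths; allowing corners in the interior of edges of the geometric
  realisation changes only the constant \<open>\<delta>\<close>. As the corners are arbitrary, it suffices
  to require the condition for one side.\<close>

definition hyperbolic_graph :: "'v ugraph \<Rightarrow> bool" where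
  "hyperbolic_graph \<Gamma> \<longleftrightarrow>
     (\<exists>\<delta>::nat. \<forall>x y z p q r.
        geodesic \<Gamma> x p y \<and> geodesic \<Gamma> y q z \<and> geodesic \<Gamma> z r x \<longrightarrow>
        (\<forall>u\<in>set p. \<exists>v\<in>set q \<union> set r. graph_dist \<Gamma> u v \<le> enat \<delta>))"

definition neighbours :: "'v ugraph \<Rightarrow> 'v \<Rightarrow> 'v set" where
  "neighbours \<Gamma> v = {u \<in> verts \<Gamma>. u \<noteq> v \<and> {u, v} \<in> edges \<Gamma>}"

definition delete_vertex :: "'v ugraph \<Rightarrow> 'v \<Rightarrow> 'v ugraph" where
  "delete_vertex \<Gamma> v = \<lparr>verts = verts \<Gamma> - {v}, edges = {e \<in> edges \<Gamma>. v \<notin> e}\<rparr>"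

definition angle :: "'v ugraph \<Rightarrow> 'v \<Rightarrow> 'v \<Rightarrow> 'v \<Rightarrow> enat" where
  "angle \<Gamma> v x y = graph_dist (delete_vertex \<Gamma> v) x y"

definition fine_at :: "'v ugraph \<Rightarrow> 'v \<Rightarrow> bool" where
  "fine_at \<Gamma> v \<longleftrightarrow>
     (\<forall>x\<in>neighbours \<Gamma> v. \<forall>r::nat. finite {y \<in> neighbours \<Gamma> v. angle \<Gamma> v x y \<le> enat r})"

section \<open>Generating sets, cosets and commensurators\<close>

definition generating_set :: "('a, 'm) monoid_scheme \<Rightarrow> 'a set \<Rightarrow> bool" where
  "generating_set G S \<longleftrightarrow> S \<subseteq> carrier G \<and> generate G S = carrier G"

text \<open>Meaningful only if \<open>S\<close> generates \<open>G\<close>; otherwise the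
  minimum may be taken over the empty set.\<close>

definition word_dist :: "('a, 'm) monoid_scheme \<Rightarrow> 'a set \<Rightarrow> 'a \<Rightarrow> 'a \<Rightarrow> real" where
  "word_dist G S g h =
     real (LEAST n. \<exists>w \<in> lists (S \<union> m_inv G ` S).
             length w = n \<and> foldr (\<otimes>\<^bsub>G\<^esub>) w \<one>\<^bsub>G\<^esub> = inv\<^bsub>G\<^esub> g \<otimes>\<^bsub>G\<^esub> h)"

definition all_lcosets :: "('a, 'm) monoid_scheme \<Rightarrow> 'a set set \<Rightarrow> 'a set set" where
  "all_lcosets G \<P> = (\<Union>P\<in>\<P>. lcosets\<^bsub>G\<^esub> P)"

text \<open>Intended for \<open>K\<close> a subgroup of \<open>P\<close>, with \<open>P\<close> a subgroup of \<open>G\<close>.\<close>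

definition finite_index :: "('a, 'm) monoid_scheme \<Rightarrow> 'a set \<Rightarrow> 'a set \<Rightarrow> bool" where
  "finite_index G K P \<longleftrightarrow> finite (rcosets\<^bsub>G\<lparr>carrier := P\<rparr>\<^esub> K)"

definition commensurator :: "('a, 'm) monoid_scheme \<Rightarrow> 'a set \<Rightarrow> 'a set" where
  "commensurator G P =
     {g \<in> carrier G.
        let P' = (g <#\<^bsub>G\<^esub> P) #>\<^bsub>G\<^esub> inv\<^bsub>G\<^esub> g
        in finite_index G (P \<inter> P') P \<and> finite_index G (P \<inter> P') P'}"

section \<open>Quasi-isometries\<close>

definition quasi_isometry_with ::
    "real \<Rightarrow> real \<Rightarrow> 'a set \<Rightarrow> ('a \<Rightarrow> 'a \<Rightarrow> real) \<Rightarrow> 'b set \<Rightarrow> ('b \<Rightarrow> 'b \<Rightarrow> real) \<Rightarrow> ('a \<Rightarrow> 'b) \<Rightarrow> bool"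
  where
  "quasi_isometry_with L C X d Y d' f \<longleftrightarrow>
     L \<ge> 1 \<and> C \<ge> 0 \<and> f \<in> X \<rightarrow> Y \<and>
     (\<forall>x\<in>X. \<forall>y\<in>X. d x y / L - C \<le> d' (f x) (f y) \<and> d' (f x) (f y) \<le> L * d x y + C) \<and>
     (\<forall>y\<in>Y. \<exists>x\<in>X. d' (f x) y \<le> C)"

definition quasi_isometry ::
    "'a set \<Rightarrow> ('a \<Rightarrow> 'a \<Rightarrow> real) \<Rightarrow> 'b set \<Rightarrow> ('b \<Rightarrow> 'b \<Rightarrow> real) \<Rightarrow> ('a \<Rightarrow> 'b) \<Rightarrow> bool"
  where
  "quasi_isometry X d Y d' f \<longleftrightarrow> (\<exists>L C. quasi_isometry_with L C X d Y d' f)"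

definition hausdorff_dist :: "('a \<Rightarrow> 'a \<Rightarrow> real) \<Rightarrow> 'a set \<Rightarrow> 'a set \<Rightarrow> ereal" where
  "hausdorff_dist d A B =
     max (SUP a\<in>A. INF b\<in>B. ereal (d a b)) (SUP b\<in>B. INF a\<in>A. ereal (d a b))"

text \<open>In what follows, \<open>A\<close> and \<open>B\<close> are the finite generating sets of \<open>G\<close> and \<open>H\<close>
  that define the word metrics.\<close>

definition coset_relation ::
    "('a, 'm) monoid_scheme \<Rightarrow> 'a set set \<Rightarrow> ('b, 'n) monoid_scheme \<Rightarrow> 'b set \<Rightarrow> 'b set set
      \<Rightarrow> real \<Rightarrow> ('a \<Rightarrow> 'b) \<Rightarrow> ('a set \<times> 'b set) set"
  where
  "coset_relation G \<P> H B \<Q> M q =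
     {(U, V) \<in> all_lcosets G \<P> \<times> all_lcosets H \<Q>.
        hausdorff_dist (word_dist H B) (q ` U) V < ereal M}"

definition qi_pairs_with ::
    "real \<Rightarrow> real \<Rightarrow> real \<Rightarrow> ('a, 'm) monoid_scheme \<Rightarrow> 'a set \<Rightarrow> 'a set set
      \<Rightarrow> ('b, 'n) monoid_scheme \<Rightarrow> 'b set \<Rightarrow> 'b set set \<Rightarrow> ('a \<Rightarrow> 'b) \<Rightarrow> bool"
  where
  "qi_pairs_with L C M G A \<P> H B \<Q> q \<longleftrightarrow>
     M \<ge> 0 \<and>
     quasi_isometry_with L C (carrier G) (word_dist G A) (carrier H) (word_dist H B) q \<and>
     fst ` coset_relation G \<P> H B \<Q> M q = all_lcosets G \<P> \<and>
     snd ` coset_relation G \<P> H B \<Q> M q = all_lcosets H \<Q>"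

definition qi_pairs ::
    "('a, 'm) monoid_scheme \<Rightarrow> 'a set \<Rightarrow> 'a set set
      \<Rightarrow> ('b, 'n) monoid_scheme \<Rightarrow> 'b set \<Rightarrow> 'b set set \<Rightarrow> ('a \<Rightarrow> 'b) \<Rightarrow> bool"
  where
  "qi_pairs G A \<P> H B \<Q> q \<longleftrightarrow> (\<exists>L C M. qi_pairs_with L C M G A \<P> H B \<Q> q)"

definition qi_characteristic :: "('a, 'm) monoid_scheme \<Rightarrow> 'a set \<Rightarrow> 'a set set \<Rightarrow> bool" where
  "qi_characteristic G A \<P> \<longleftrightarrow>
     finite \<P> \<and>
     (\<forall>P\<in>\<P>. finite_index G P (commensurator G P)) \<and>
     (\<forall>L\<ge>1. \<forall>C\<ge>0. \<exists>M\<ge>0. \<forall>f.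
        quasi_isometry_with L C (carrier G) (word_dist G A) (carrier G) (word_dist G A) f \<longrightarrow>
        qi_pairs_with L C M G A \<P> G A \<P> f)"

section \<open>Hyperbolically embedded collections\<close>

definition coned_off_cayley_graph ::
    "('a, 'm) monoid_scheme \<Rightarrow> 'a set set \<Rightarrow> 'a set \<Rightarrow> ('a + 'a set) ugraph" where
  "coned_off_cayley_graph G \<P> S =
     \<lparr>verts = Inl ` carrier G \<union> Inr ` all_lcosets G \<P>,
      edges = {{Inl g, Inl (g \<otimes>\<^bsub>G\<^esub> s)} | g s. g \<in> carrier G \<and> s \<in> S}
            \<union> {{Inl x, Inr U} | x U. U \<in> all_lcosets G \<P> \<and> x \<in> U}\<rparr>"

definition hyp_embedded :: "'a set set \<Rightarrow> ('a, 'm) monoid_scheme \<Rightarrow> 'a set \<Rightarrow> bool" where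
  "hyp_embedded \<P> G S \<longleftrightarrow>
     connected_graph (coned_off_cayley_graph G \<P> S) \<and>
     hyperbolic_graph (coned_off_cayley_graph G \<P> S) \<and>
     (\<forall>U\<in>all_lcosets G \<P>. fine_at (coned_off_cayley_graph G \<P> S) (Inr U))"

end

theory Submission
  imports Defs
begin

text \<open>
  The collection \<open>\<P>\<close> consists of coarse stabilisers. Let \<open>q_inv\<close> be a quasi-inverse of \<open>q\<close>. For
  \<open>g \<in> G\<close> the maps \<open>h \<mapsto> q (g q_inv h)\<close> are quasi-isometries of \<open>H\<close> whose constants do not depend on
  \<open>g\<close>, so, as \<open>\<Q>\<close> is qi-characteristic, they permute the cosets in \<open>H/\<Q>\<close> up to a uniform Hausdorff
  distance. Hence \<open>G\<close> permutes, up to a uniform Hausdorff distance, the subsets \<open>q_inv V\<close> with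
  \<open>V \<in> H/\<Q>\<close>. Only finitely many of these subsets meet a given ball, so a pigeonhole argument shows
  that there are finitely many orbits and that each \<open>q_inv V\<close> is at finite Hausdorff distance from
  the subgroup of those \<open>g\<close> that move it by a finite Hausdorff distance
  (\<open>close_coarse_stabiliser\<close>). One such subgroup for each orbit gives \<open>\<P>\<close>. By construction \<open>q\<close> is a
  quasi-isometry of pairs, and distinct cosets in \<open>G/\<P>\<close> are at infinite Hausdorff distance
  (\<open>ex_stabiliser_collection\<close>).

  The pigeonhole argument needs that elements of \<open>H/\<Q>\<close> at finite Hausdorff distance are at
  uniformly bounded distance. In fact they are equal if \<open>H\<close> is infinite (\<open>cosets_separated\<close>): by
  fineness at the cone vertex of \<open>V\<close>, an infinite coset \<open>V\<close> cannot stay close to another coset, for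
  the cone vertex of the latter would give short detours around that of \<open>V\<close>; and if some
  \<open>Q \<in> \<Q>\<close> is finite, then its commensurator is \<open>H\<close>, so that \<open>H\<close> is finite as well.

  It remains to transfer hyperbolicity and fineness to the coned-off graph of \<open>G\<close>
  (\<open>hyp_embedded_pullback\<close>). The map \<open>q\<close> and the correspondence between cosets define a
  quasi-isometry of coned-off Cayley graphs, since \<open>B\<close> is finite and distances with respect to
  \<open>B\<close> therefore dominate those with respect to \<open>T\<close> up to a factor. That hyperbolicity of graphs is
  inherited along quasi-isometric embeddings is the stability of quasi-geodesics (the Morse lemma),
  proved from slim triangles in the first part (\<open>slim_pullback\<close>). For fineness, distinct cosets in
  \<open>G/\<P>\<close> correspond to distinct cosets in \<open>H/\<Q>\<close> because they are at infinite Hausdorff distance.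
  A path of \<open>G\<close> that avoids one cone vertex thus maps to a path of comparable length that avoids the
  corresponding cone vertex, so that a bounded angle at the former gives a bounded angle at the
  latter (\<open>fine_at_pullback\<close>).
\<close>

section \<open>Slim triangles in integer-valued geodesic metrics\<close>

text \<open>The form in which exponential growth enters below: in \<open>interval_near_quasi_geodesic\<close>, a large
  deviation \<open>D\<close> needs a detour of length exponential in \<open>D\<close>, whereas a quasi-geodesic only
  affords a linear one.\<close>

lemma linear_le_exp:
  fixes a b k \<delta> :: nat
  shows "\<exists>N. \<forall>D\<ge>N. \<exists>m. k + m * \<delta> < D \<and> a * D + b \<le> 2 ^ m"
proof -
  \<comment> \<open>The constant \<open>t\<close> is such that \<open>a * D + b \<le> t * m\<close>, and \<open>t * m \<le> m * m / 4 \<le> 2 ^ m\<close> once \<open>m \<ge> 4 * t\<close>.\<close>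
  define e where "e = Suc \<delta>"
  define t where "t = a * (k + e) + a * e + b + 1"
  have quad: "m * m \<le> 4 * 2 ^ m" for m :: nat
  proof (induction m rule: less_induct)
    case (less m)
    show ?case
    proof (cases "m < 4")
      case True
      then have "m \<in> {0,1,2,3}" by auto
      then show ?thesis by auto
    next
      case False
      then obtain p where p: "m = Suc p" "p \<ge> 3" by (cases m) auto
      then have "p * p \<le> 4 * 2 ^ p" using less by auto
      moreover have "Suc p * Suc p \<le> 2 * (p * p)"
      proof -
        have "3 * p \<le> p * p" using p by simp
        then have "2 * p + 1 \<le> p * p" using p by linarith
        then show ?thesis by simp
      qed
      ultimately show ?thesis using p by simp
    qed
  qed
  show ?thesis
  proof (rule exI[of _ "k + e * (4 * t + 1) + 1"], intro allI impI)
    fix D assume D: "k + e * (4 * t + 1) + 1 \<le> D"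
    define m where "m = (D - k - 1) div e"
    have e: "e > 0" by (simp add: e_def)
    have m1: "m * e \<le> D - k - 1" unfolding m_def by simp
    have "m \<ge> 4 * t + 1"
      using D e unfolding m_def by (simp add: less_eq_div_iff_mult_less_eq algebra_simps)
    have m2: "D - k - 1 < (m + 1) * e"
      unfolding m_def using e
      by (metis add.commute dividend_less_times_div mult.commute plus_1_eq_Suc times_nat.simps(2) distrib_right nat_mult_1)
    have "m * \<delta> \<le> m * e" by (simp add: e_def)
    then have 1: "k + m * \<delta> < D" using m1 D by linarith
    have "D \<le> k + (m + 1) * e" using m2 D by linarith
    then have "a * D + b \<le> a * (k + (m + 1) * e) + b" by simp
    also have "\<dots> = a * (k + e) + a * e * m + b" by (simp add: algebra_simps)
    also have "\<dots> \<le> t * m"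
    proof -
      have "m \<ge> 1" using \<open>m \<ge> 4 * t + 1\<close> by simp
      then have "a * (k + e) \<le> a * (k + e) * m" "b \<le> b * m" by simp_all
      moreover have "t * m = a * (k + e) * m + a * e * m + b * m + m" unfolding t_def by (simp add: algebra_simps)
      ultimately show ?thesis by linarith
    qed
    also have "\<dots> \<le> 2 ^ m"
    proof -
      have "4 * (t * m) \<le> m * m" using \<open>m \<ge> 4 * t + 1\<close> by simp
      then show ?thesis using quad[of m] by linarith
    qed
    finally show "\<exists>m. k + m * \<delta> < D \<and> a * D + b \<le> 2 ^ m" using 1 by blast
  qed
qed

text \<open>The vertices of a connected graph with the path metric. The axiom \<open>d_step\<close>, a first step
  towards \<open>y\<close>, is what makes the metric geodesic.\<close>

locale geodesic_nat_metric =
  fixes X :: "'v set" and d :: "'v \<Rightarrow> 'v \<Rightarrow> nat"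
  assumes d_zero: "\<lbrakk>x \<in> X; y \<in> X\<rbrakk> \<Longrightarrow> d x y = 0 \<longleftrightarrow> x = y"
    and d_sym: "\<lbrakk>x \<in> X; y \<in> X\<rbrakk> \<Longrightarrow> d x y = d y x"
    and d_triangle: "\<lbrakk>x \<in> X; y \<in> X; z \<in> X\<rbrakk> \<Longrightarrow> d x z \<le> d x y + d y z"
    and d_step: "\<lbrakk>x \<in> X; y \<in> X; x \<noteq> y\<rbrakk> \<Longrightarrow> \<exists>z\<in>X. d x z = 1 \<and> d x y = Suc (d z y)"
begin

text \<open>The interval is the union of all geodesics from \<open>x\<close> to \<open>y\<close>. As geodesics with common ends are
  uniformly close to each other in a hyperbolic space (\<open>slim_thin\<close> below), intervals can take the
  place of geodesics in the definition of slim triangles.\<close>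

definition interval :: "'v \<Rightarrow> 'v \<Rightarrow> 'v set" where
  "interval x y = {u \<in> X. d x u + d u y = d x y}"

definition slim :: "nat \<Rightarrow> bool" where
  "slim \<delta> \<longleftrightarrow> (\<forall>x\<in>X. \<forall>y\<in>X. \<forall>z\<in>X. \<forall>u\<in>interval x y.
     \<exists>v\<in>interval y z \<union> interval z x. d u v \<le> \<delta>)"

text \<open>The lower bound on distances is solved for \<open>j - i\<close>, so that all constants are natural numbers.\<close>

definition quasi_geodesic :: "nat \<Rightarrow> nat \<Rightarrow> nat \<Rightarrow> (nat \<Rightarrow> 'v) \<Rightarrow> bool" where
  "quasi_geodesic L C n c \<longleftrightarrow>
     (\<forall>i\<le>n. c i \<in> X) \<and>
     (\<forall>i j. i \<le> j \<and> j \<le> n \<longrightarrow>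
        d (c i) (c j) \<le> L * (j - i) + C \<and> j - i \<le> L * (d (c i) (c j) + C))"

lemma intervalD:
  assumes "u \<in> interval x y"
  shows "u \<in> X" "d x u + d u y = d x y"
  using assms by (auto simp: interval_def)

lemma d_self [simp]: "x \<in> X \<Longrightarrow> d x x = 0"
  by (simp add: d_zero)

lemma interval_sym: "\<lbrakk>x \<in> X; y \<in> X\<rbrakk> \<Longrightarrow> interval x y = interval y x"
  by (auto simp: interval_def d_sym)

lemma interval_ends: "\<lbrakk>x \<in> X; y \<in> X\<rbrakk> \<Longrightarrow> x \<in> interval x y" "\<lbrakk>x \<in> X; y \<in> X\<rbrakk> \<Longrightarrow> y \<in> interval x y"
  by (auto simp: interval_def)

lemma ex_geodesic:
  assumes "x \<in> X" "y \<in> X"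
  shows "\<exists>\<gamma>. \<gamma> 0 = x \<and> \<gamma> (d x y) = y \<and> (\<forall>i\<le>d x y. \<gamma> i \<in> X) \<and> (\<forall>i<d x y. d (\<gamma> i) (\<gamma> (Suc i)) \<le> 1)"
  using assms
proof (induction "d x y" arbitrary: x)
  case 0
  then show ?case using d_zero by (intro exI[of _ "\<lambda>_. x"]) auto
next
  case (Suc n)
  then have "x \<noteq> y" by auto
  then obtain z where z: "z \<in> X" "d x z = 1" "d x y = Suc (d z y)"
    using d_step Suc.prems by blast
  with Suc.hyps have "n = d z y" by simp
  from Suc.hyps(1)[OF this z(1) Suc.prems(2)] obtain \<gamma> where
    g: "\<gamma> 0 = z" "\<gamma> (d z y) = y" "\<forall>i\<le>d z y. \<gamma> i \<in> X" "\<forall>i<d z y. d (\<gamma> i) (\<gamma> (Suc i)) \<le> 1"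
    by blast
  show ?case
    by (intro exI[of _ "\<lambda>i. case i of 0 \<Rightarrow> x | Suc j \<Rightarrow> \<gamma> j"])
      (use g z Suc.prems in \<open>auto split: nat.splits\<close>)
qed

lemma path_length:
  assumes "\<And>i. i \<le> n \<Longrightarrow> \<gamma> i \<in> X" "\<And>i. i < n \<Longrightarrow> d (\<gamma> i) (\<gamma> (Suc i)) \<le> 1" "i \<le> j" "j \<le> n"
  shows "d (\<gamma> i) (\<gamma> j) \<le> j - i"
  using assms(3,4)
proof (induction j)
  case 0
  then show ?case using assms by auto
next
  case (Suc j)
  show ?case
  proof (cases "i = Suc j")
    case True
    then show ?thesis using assms Suc by auto
  next
    case False
    then have "d (\<gamma> i) (\<gamma> j) \<le> j - i" using Suc by auto
    moreover have "d (\<gamma> i) (\<gamma> (Suc j)) \<le> d (\<gamma> i) (\<gamma> j) + d (\<gamma> j) (\<gamma> (Suc j))"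
      using assms Suc by (intro d_triangle) auto
    ultimately show ?thesis using assms(2)[of j] Suc False by simp
  qed
qed

lemma interval_point:
  assumes "x \<in> X" "y \<in> X" "k \<le> d x y"
  shows "\<exists>u\<in>interval x y. d x u = k"
proof -
  obtain \<gamma> where g: "\<gamma> 0 = x" "\<gamma> (d x y) = y" "\<forall>i\<le>d x y. \<gamma> i \<in> X" "\<forall>i<d x y. d (\<gamma> i) (\<gamma> (Suc i)) \<le> 1"
    using ex_geodesic assms by blast
  have "d (\<gamma> 0) (\<gamma> k) \<le> k" "d (\<gamma> k) (\<gamma> (d x y)) \<le> d x y - k"
    using path_length[of "d x y" \<gamma> 0 k] path_length[of "d x y" \<gamma> k "d x y"] g assms by auto
  moreover have "d x y \<le> d x (\<gamma> k) + d (\<gamma> k) y"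
    using g assms by (intro d_triangle) auto
  ultimately have "d x (\<gamma> k) = k" "d x (\<gamma> k) + d (\<gamma> k) y = d x y"
    using g assms by auto
  then show ?thesis using g assms by (intro bexI[of _ "\<gamma> k"]) (auto simp: interval_def)
qed

lemma interval_trans:
  assumes "x \<in> X" "y \<in> X" "u \<in> interval x y" "a \<in> interval x u" "b \<in> interval u y"
  shows "a \<in> interval x y" "b \<in> interval x y" "u \<in> interval a b"
    "d a u = d x u - d x a" "d x b = d x u + d u b"
proof -
  have X: "u \<in> X" "a \<in> X" "b \<in> X" using assms intervalD by auto
  have "d x y \<le> d x a + d a y" "d a y \<le> d a b + d b y" "d a b \<le> d a u + d u b"
    "d a y \<le> d a u + d u y" "d x y \<le> d x b + d b y" "d x b \<le> d x u + d u b" "d x b \<le> d x a + d a b"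
    using assms X d_triangle by auto
  moreover have "d x u + d u y = d x y" "d x a + d a u = d x u" "d u b + d b y = d u y"
    using assms intervalD by auto
  ultimately show "a \<in> interval x y" "b \<in> interval x y" "u \<in> interval a b"
    "d a u = d x u - d x a" "d x b = d x u + d u b"
    using X unfolding interval_def by auto
qed

lemma ex_geodesic_through:
  assumes "x \<in> X" "y \<in> X" "u \<in> interval x y"
  shows "\<exists>\<gamma>. \<gamma> 0 = x \<and> \<gamma> (d x y) = y \<and> \<gamma> (d x u) = u \<and> (\<forall>i\<le>d x y. \<gamma> i \<in> interval x y) \<and>
    (\<forall>i j. i \<le> j \<and> j \<le> d x y \<longrightarrow> d (\<gamma> i) (\<gamma> j) = j - i)"
proof -
  have u: "u \<in> X" "d x u + d u y = d x y" using assms intervalD by auto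
  obtain \<alpha> where a: "\<alpha> 0 = x" "\<alpha> (d x u) = u" "\<forall>i\<le>d x u. \<alpha> i \<in> X" "\<forall>i<d x u. d (\<alpha> i) (\<alpha> (Suc i)) \<le> 1"
    using ex_geodesic assms u by blast
  obtain \<beta> where b: "\<beta> 0 = u" "\<beta> (d u y) = y" "\<forall>i\<le>d u y. \<beta> i \<in> X" "\<forall>i<d u y. d (\<beta> i) (\<beta> (Suc i)) \<le> 1"
    using ex_geodesic assms u by blast
  define \<gamma> where "\<gamma> i = (if i \<le> d x u then \<alpha> i else \<beta> (i - d x u))" for i
  have 1: "\<gamma> i \<in> X" if "i \<le> d x y" for i
    using that a b u unfolding \<gamma>_def by auto
  have 2: "d (\<gamma> i) (\<gamma> (Suc i)) \<le> 1" if "i < d x y" for i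
  proof (cases "i = d x u")
    case True
    then show ?thesis using that a b u unfolding \<gamma>_def by auto
  next
    case False
    then show ?thesis using that a b u unfolding \<gamma>_def by (auto simp: Suc_diff_le)
  qed
  have ends: "\<gamma> 0 = x" "\<gamma> (d x y) = y" "\<gamma> (d x u) = u"
  proof -
    show "\<gamma> 0 = x" "\<gamma> (d x u) = u" using a unfolding \<gamma>_def by auto
    show "\<gamma> (d x y) = y"
    proof (cases "d u y = 0")
      case True
      then show ?thesis using a u assms d_zero[of u y] unfolding \<gamma>_def by auto
    next
      case False
      moreover have "d x y - d x u = d u y" "(d x y \<le> d x u) = (d u y = 0)" using u by auto
      ultimately show ?thesis using b unfolding \<gamma>_def by presburger
    qed
  qed
  have eq: "d (\<gamma> i) (\<gamma> j) = j - i" if "i \<le> j" "j \<le> d x y" for i j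
  proof -
    have "d (\<gamma> 0) (\<gamma> i) \<le> i - 0" "d (\<gamma> i) (\<gamma> j) \<le> j - i" "d (\<gamma> j) (\<gamma> (d x y)) \<le> d x y - j"
      using path_length[of "d x y" \<gamma> 0 i] path_length[of "d x y" \<gamma> i j] path_length[of "d x y" \<gamma> j "d x y"]
        1 2 that by simp_all
    moreover have "d x y \<le> d x (\<gamma> j) + d (\<gamma> j) y" "d x (\<gamma> j) \<le> d x (\<gamma> i) + d (\<gamma> i) (\<gamma> j)"
      using that assms 1 by (auto intro!: d_triangle)
    ultimately show ?thesis using ends that by simp
  qed
  have "\<gamma> i \<in> interval x y" if "i \<le> d x y" for i
    using eq[of 0 i] eq[of i "d x y"] ends that 1[of i] unfolding interval_def by auto
  then show ?thesis using ends eq by blast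
qed

text \<open>For the degenerate triangle \<open>x\<close>, \<open>v\<close>, \<open>y\<close>, a point of the interval between \<open>v\<close> and \<open>x\<close> or
  \<open>y\<close> that is \<open>\<delta>\<close>-close to \<open>u\<close> has almost the same distance to \<open>x\<close> as \<open>v\<close>, so it is close to \<open>v\<close>.\<close>

lemma slim_thin:
  assumes "slim \<delta>" "x \<in> X" "y \<in> X" "u \<in> interval x y" "v \<in> interval x y" "d x u = d x v"
  shows "d u v \<le> 2 * \<delta>"
proof -
  have X: "u \<in> X" "v \<in> X" using assms intervalD by auto
  have e: "d x u + d u y = d x y" "d x v + d v y = d x y" using intervalD(2)[OF assms(4)] intervalD(2)[OF assms(5)] by auto
  obtain w where w: "w \<in> interval y v \<union> interval v x" "d u w \<le> \<delta>"
    using assms X unfolding slim_def by blast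
  then have wX: "w \<in> X" using intervalD by auto
  have t: "d u v \<le> d u w + d w v" "d x u \<le> d x w + d w u" "d u y \<le> d u w + d w y"
    using d_triangle assms(2,3) X wX unfolding \<open>d x u = d x v\<close>[symmetric] by blast+
  from w(1) have "d w v \<le> \<delta>"
  proof
    assume "w \<in> interval y v"
    then have "d y w + d w v = d y v" using intervalD by auto
    then show ?thesis using t e assms w X wX by (simp add: d_sym)
  next
    assume "w \<in> interval v x"
    then have "d v w + d w x = d v x" using intervalD by auto
    then show ?thesis using t e assms w X wX by (simp add: d_sym)
  qed
  then show ?thesis using t w by simp
qed

text \<open>Repeated bisection of the path: each of the \<open>m\<close> halvings costs one slim triangle. The distance
  thus grows only logarithmically with the number of steps, which is the source of the
  stability of quasi-geodesics.\<close>

lemma slim_coarse_path: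
  assumes "slim \<delta>" "\<And>k. i \<le> k \<Longrightarrow> k \<le> j \<Longrightarrow> c k \<in> X"
    "\<And>k. i \<le> k \<Longrightarrow> k < j \<Longrightarrow> d (c k) (c (Suc k)) \<le> K"
    "i \<le> j" "j - i \<le> 2 ^ m" "u \<in> interval (c i) (c j)"
  shows "\<exists>k\<in>{i..j}. d u (c k) \<le> m * \<delta> + K"
  using assms(2-)
proof (induction m arbitrary: i j u)
  case 0
  have u: "u \<in> X" "d (c i) u + d u (c j) = d (c i) (c j)" using 0 intervalD by auto
  have "j = i \<or> j = Suc i" using 0 by auto
  then have "d (c i) (c j) \<le> K"
    using 0 by auto
  then have "d u (c j) \<le> K" using u by simp
  then show ?case using 0 by (intro bexI[of _ j]) auto
next
  case (Suc m)
  define k where "k = (i + j) div 2"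
  have k: "i \<le> k" "k \<le> j" "k - i \<le> 2 ^ m" "j - k \<le> 2 ^ m"
    using Suc.prems(3,4) by (auto simp: k_def)
  have cX: "c i \<in> X" "c j \<in> X" "c k \<in> X" using Suc.prems k by auto
  have uX: "u \<in> X" using Suc.prems intervalD by auto
  obtain v where v: "v \<in> interval (c j) (c k) \<union> interval (c k) (c i)" "d u v \<le> \<delta>"
    using assms(1) cX Suc.prems(5) unfolding slim_def by blast
  have "\<exists>l\<in>{i..j}. d v (c l) \<le> m * \<delta> + K"
    using v(1)
  proof
    assume "v \<in> interval (c j) (c k)"
    then have "v \<in> interval (c k) (c j)" using interval_sym cX by auto
    with Suc.IH[of k j v] have "\<exists>l\<in>{k..j}. d v (c l) \<le> m * \<delta> + K"
      using k Suc.prems by auto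
    then show ?thesis using k by force
  next
    assume "v \<in> interval (c k) (c i)"
    then have "v \<in> interval (c i) (c k)" using interval_sym cX by auto
    with Suc.IH[of i k v] have "\<exists>l\<in>{i..k}. d v (c l) \<le> m * \<delta> + K"
      using k Suc.prems by auto
    then show ?thesis using k by force
  qed
  then obtain l where l: "l \<in> {i..j}" "d v (c l) \<le> m * \<delta> + K" by blast
  have "d u (c l) \<le> d u v + d v (c l)"
    using uX v intervalD l Suc.prems(1)[of l] by (auto intro!: d_triangle)
  then show ?case using l v by (intro bexI[of _ l]) auto
qed

lemma quadrilateral:
  assumes "slim \<delta>" "a \<in> X" "b \<in> X" "p \<in> X" "r \<in> X" "u \<in> interval a b"
  shows "\<exists>v\<in>interval a p \<union> interval p r \<union> interval r b. d u v \<le> 2 * \<delta>"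
proof -
  have uX: "u \<in> X" using assms intervalD by auto
  obtain w where w: "w \<in> interval b p \<union> interval p a" "d u w \<le> \<delta>"
    using assms unfolding slim_def by blast
  have wX: "w \<in> X" using w intervalD by auto
  show ?thesis
  proof (cases "w \<in> interval p a")
    case True
    then show ?thesis using w assms interval_sym by (intro bexI[of _ w]) auto
  next
    case False
    then have "w \<in> interval b p" using w by auto
    then obtain v where v: "v \<in> interval p r \<union> interval r b" "d w v \<le> \<delta>"
      using assms unfolding slim_def by blast
    have "d u v \<le> d u w + d w v" using uX wX v intervalD by (auto intro!: d_triangle)
    then show ?thesis using v w by (intro bexI[of _ v]) auto
  qed
qed

text \<open>Let \<open>w\<close> be a point of the interval at maximal distance \<open>D\<close> from the quasi-geodesic. Go from \<open>w\<close>
  a distance \<open>2 D\<close> to either side, and from there by at most \<open>D\<close> to the quasi-geodesic. The part of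
  the quasi-geodesic in between has length linear in \<open>D\<close>, so by \<open>slim_coarse_path\<close> the distance \<open>D\<close>
  is at most logarithmic in \<open>D\<close>.\<close>

lemma interval_near_quasi_geodesic:
  assumes "slim \<delta>"
  shows "\<exists>D. \<forall>n c. quasi_geodesic L C n c \<longrightarrow>
    (\<forall>u\<in>interval (c 0) (c n). \<exists>k\<le>n. d u (c k) \<le> D)"
proof -
  obtain N where N: "\<And>D. D \<ge> N \<Longrightarrow> \<exists>m. (2 * \<delta> + L + C) + m * \<delta> < D \<and> 6 * L * D + L * C \<le> 2 ^ m"
    using linear_le_exp by meson
  show ?thesis
  proof (rule exI[of _ N], intro allI impI ballI)
    fix n c u assume c: "quasi_geodesic L C n c" and u: "u \<in> interval (c 0) (c n)"
    have cX: "c i \<in> X" if "i \<le> n" for i using c that unfolding quasi_geodesic_def by blast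
    have cu: "d (c i) (c j) \<le> L * (j - i) + C" "j - i \<le> L * (d (c i) (c j) + C)"
      if "i \<le> j" "j \<le> n" for i j using c that unfolding quasi_geodesic_def by blast+
    define \<rho> where "\<rho> v = Min ((\<lambda>k. d v (c k)) ` {..n})" for v
    have \<rho>_le: "\<rho> v \<le> d v (c k)" if "k \<le> n" for v k
      unfolding \<rho>_def using that by (intro Min_le) auto
    have \<rho>_ex: "\<exists>k\<le>n. d v (c k) = \<rho> v" for v
    proof -
      have "\<rho> v \<in> (\<lambda>k. d v (c k)) ` {..n}" unfolding \<rho>_def by (intro Min_in) auto
      then show ?thesis by auto
    qed
    have bnd: "\<forall>v. v \<in> interval (c 0) (c n) \<longrightarrow> \<rho> v \<le> d (c 0) (c n)"
    proof (intro allI impI)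
      fix v assume v: "v \<in> interval (c 0) (c n)"
      have "\<rho> v \<le> d v (c n)" using \<rho>_le by simp
      then show "\<rho> v \<le> d (c 0) (c n)" using intervalD(2)[OF v] by simp
    qed
    obtain w where w: "w \<in> interval (c 0) (c n)"
      and wmax: "\<And>v. v \<in> interval (c 0) (c n) \<Longrightarrow> \<rho> v \<le> \<rho> w"
      using ex_has_greatest_nat[of "\<lambda>v. v \<in> interval (c 0) (c n)" u \<rho> "d (c 0) (c n) + 1"] u bnd
      by (metis less_Suc_eq_le Suc_eq_plus1)
    have wX: "w \<in> X" "d (c 0) w + d w (c n) = d (c 0) (c n)" using intervalD w by auto
    define D where "D = \<rho> w"
    have "D < N"
    proof (rule ccontr)
      assume "\<not> D < N"
      then obtain m where m: "(2 * \<delta> + L + C) + m * \<delta> < D" "6 * L * D + L * C \<le> 2 ^ m"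
        using N[of D] by auto
      \<comment> \<open>The point \<open>a\<close> is at distance \<open>2 D\<close> from \<open>w\<close> towards the end \<open>z\<close>, or \<open>z\<close> itself if \<open>z\<close> is nearer.
        Either way no geodesic from \<open>a\<close> to its closest point \<open>c k\<close> comes nearer than \<open>D\<close> to \<open>w\<close>.\<close>
      have aux: "\<exists>a k. a \<in> X \<and> k \<le> n \<and> d a (c k) \<le> D \<and> a \<in> interval z w \<and> d a w \<le> 2 * D \<and>
          (\<forall>v\<in>interval a (c k). D \<le> d w v)"
        if z: "z = c 0 \<or> z = c n" for z
      proof (cases "d z w \<le> 2 * D")
        case True
        have zX: "z \<in> X" using z cX by auto
        obtain k where k: "z = c k" "k \<le> n" using z by blast
        have "v = z" if "v \<in> interval z z" for v
          using intervalD[OF that] zX d_zero[of v z] by simp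
        then show ?thesis
          using True zX k wX \<rho>_le[of k w] unfolding D_def by (intro exI[of _ z] exI[of _ k]) (auto simp: interval_ends)
      next
        case False
        have zX: "z \<in> X" using z cX by auto
        obtain a where a: "a \<in> interval w z" "d w a = 2 * D"
          using interval_point[of w z "2 * D"] False zX wX by (auto simp: d_sym)
        have aX: "a \<in> X" "a \<in> interval z w" using a intervalD interval_sym zX wX by auto
        have "a \<in> interval (c 0) (c n)"
          using z
        proof
          assume "z = c 0"
          then show ?thesis using interval_trans(1)[OF _ _ w, of a w] aX wX cX by (simp add: interval_ends)
        next
          assume "z = c n"
          then show ?thesis using interval_trans(2)[OF _ _ w, of w a] a wX cX by (simp add: interval_ends)
        qed
        then have "\<rho> a \<le> D" using wmax D_def by auto
        then obtain k where k: "k \<le> n" "d a (c k) \<le> D" using \<rho>_ex[of a] by auto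
        have "D \<le> d w v" if v: "v \<in> interval a (c k)" for v
        proof -
          have "v \<in> X" using v intervalD by auto
          have "d w a \<le> d w v + d v a" "d v a = d a v" using \<open>v \<in> X\<close> wX aX by (auto intro!: d_triangle d_sym)
          moreover have "d a v \<le> D" using intervalD(2)[OF v] k by simp
          ultimately show ?thesis using a by simp
        qed
        then show ?thesis using aX k a wX by (intro exI[of _ a] exI[of _ k]) (auto simp: d_sym)
      qed
      obtain a i where a: "a \<in> X" "i \<le> n" "d a (c i) \<le> D" "a \<in> interval (c 0) w" "d a w \<le> 2 * D"
          "\<forall>v\<in>interval a (c i). D \<le> d w v"
        using aux[of "c 0"] by blast
      obtain b j where b: "b \<in> X" "j \<le> n" "d b (c j) \<le> D" "b \<in> interval (c n) w" "d b w \<le> 2 * D"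
          "\<forall>v\<in>interval b (c j). D \<le> d w v"
        using aux[of "c n"] by blast
      have wab: "w \<in> interval a b"
        using interval_trans(3)[OF _ _ w a(4), of b] b interval_sym[of "c n" w] wX cX by auto
      have D\<delta>: "2 * \<delta> < D" using m by linarith
      obtain v where v: "v \<in> interval a (c i) \<union> interval (c i) (c j) \<union> interval (c j) b" "d w v \<le> 2 * \<delta>"
        using quadrilateral[OF assms a(1) b(1) cX[OF a(2)] cX[OF b(2)] wab] by blast
      have "v \<in> interval (c i) (c j)"
        using v a(6) b(6) D\<delta> interval_sym[OF b(1) cX[OF b(2)]] by fastforce
      have dij: "d (c i) (c j) \<le> 6 * D"
      proof -
        have "d (c i) (c j) \<le> d (c i) a + d a (c j)" "d a (c j) \<le> d a w + d w (c j)" "d w (c j) \<le> d w b + d b (c j)"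
          using a b wX cX by (auto intro!: d_triangle)
        then show ?thesis using a b wX cX by (simp add: d_sym)
      qed
      define i' where "i' = min i j"
      define j' where "j' = max i j"
      have ij: "i' \<le> j'" "j' \<le> n" using a b by (auto simp: i'_def j'_def)
      have v': "v \<in> interval (c i') (c j')" "d (c i') (c j') \<le> 6 * D"
        using \<open>v \<in> interval (c i) (c j)\<close> interval_sym[OF cX[OF a(2)] cX[OF b(2)]] dij
          d_sym[OF cX[OF a(2)] cX[OF b(2)]]
        by (auto simp: i'_def j'_def min_def max_def)
      have "j' - i' \<le> L * (d (c i') (c j') + C)" using cu ij by blast
      also have "\<dots> \<le> L * (6 * D + C)" using v' by simp
      also have "\<dots> \<le> 2 ^ m" using m by (simp add: algebra_simps)
      finally have le: "j' - i' \<le> 2 ^ m" .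
      have "\<exists>k\<in>{i'..j'}. d v (c k) \<le> m * \<delta> + (L + C)"
      proof (rule slim_coarse_path[OF assms _ _ ij(1) le v'(1)])
        show "c k \<in> X" if "i' \<le> k" "k \<le> j'" for k using that ij cX by auto
        show "d (c k) (c (Suc k)) \<le> L + C" if "i' \<le> k" "k < j'" for k
          using cu(1)[of k "Suc k"] that ij by simp
      qed
      then obtain k where k: "k \<le> n" "d v (c k) \<le> m * \<delta> + (L + C)" using ij by (meson atLeastAtMost_iff order_trans)
      have "D \<le> d w (c k)" using \<rho>_le k D_def by auto
      also have "\<dots> \<le> d w v + d v (c k)" using wX v'(1) intervalD k cX by (auto intro!: d_triangle)
      finally show False using v k m by linarith
    qed
    then have "\<rho> u < N" using wmax[OF u] D_def by simp
    then show "\<exists>k\<le>n. d u (c k) \<le> N" using \<rho>_ex[of u] by (metis less_imp_le)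
  qed
qed

text \<open>Walk along the interval and watch the index of a close point of the quasi-geodesic, which exists
  by \<open>interval_near_quasi_geodesic\<close>. This index starts at \<open>0\<close> and ends at \<open>n\<close>, so it passes \<open>k\<close> between
  two neighbouring points. The indices on both sides of \<open>k\<close> belong to points that are close to each
  other, so they differ by a bounded amount, and \<open>c k\<close> is close as well.\<close>

lemma quasi_geodesic_near_interval:
  assumes "slim \<delta>"
  shows "\<exists>R. \<forall>n c. quasi_geodesic L C n c \<longrightarrow>
    (\<forall>k\<le>n. \<exists>u\<in>interval (c 0) (c n). d (c k) u \<le> R)"
proof -
  obtain D where D: "\<And>n c u. quasi_geodesic L C n c \<Longrightarrow> u \<in> interval (c 0) (c n) \<Longrightarrow> \<exists>k\<le>n. d u (c k) \<le> D"
    using interval_near_quasi_geodesic[OF assms] by meson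
  define E where "E = L * (2 * D + 1 + C)"
  show ?thesis
  proof (intro exI[of _ "L * E + C + D"] allI impI)
    fix n c k assume c: "quasi_geodesic L C n c" and k: "k \<le> n"
    have cX: "c i \<in> X" if "i \<le> n" for i using c that unfolding quasi_geodesic_def by blast
    have cu: "d (c i) (c j) \<le> L * (j - i) + C" "j - i \<le> L * (d (c i) (c j) + C)"
      if "i \<le> j" "j \<le> n" for i j using c that unfolding quasi_geodesic_def by blast+
    let ?I = "interval (c 0) (c n)"
    \<comment> \<open>The last \<open>u\<close> with \<open>Q u\<close> is the point at which the index passes \<open>k\<close>.\<close>
    define Q where "Q u \<longleftrightarrow> u \<in> ?I \<and> (\<exists>i\<le>k. d u (c i) \<le> D)" for u
    have "Q (c 0)" using cX k unfolding Q_def by (auto simp: interval_ends intro!: exI[of _ 0])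
    moreover have "\<forall>u. Q u \<longrightarrow> d (c 0) u < d (c 0) (c n) + 1"
      using intervalD(2) unfolding Q_def by fastforce
    ultimately obtain u where u: "Q u" and umax: "\<And>v. Q v \<Longrightarrow> d (c 0) v \<le> d (c 0) u"
      using ex_has_greatest_nat[of Q "c 0" "d (c 0)"] by blast
    obtain i where i: "i \<le> k" "d u (c i) \<le> D" using u unfolding Q_def by blast
    have uI: "u \<in> ?I" using u unfolding Q_def by blast
    have uX: "u \<in> X" using uI intervalD by auto
    have "\<exists>j. k \<le> j \<and> j \<le> n \<and> d u (c j) \<le> D + 1"
    proof (cases "u = c n")
      case True
      then show ?thesis using k cX by auto
    next
      case False
      then obtain v where v: "v \<in> X" "d u v = 1" "d u (c n) = Suc (d v (c n))" using d_step uX cX by blast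
      have vI: "v \<in> interval u (c n)" using v by (auto simp: interval_def)
      then have *: "v \<in> ?I" "d (c 0) v = d (c 0) u + 1"
        using interval_trans(2,5)[OF _ _ uI, of u v] v cX uX by (auto simp: interval_ends)
      then obtain j where j: "j \<le> n" "d v (c j) \<le> D" using D[OF c] by blast
      have "\<not> Q v" using umax[of v] * by auto
      then have "k \<le> j" using j * unfolding Q_def by (meson le_cases)
      moreover have "d u (c j) \<le> d u v + d v (c j)" by (rule d_triangle[OF uX v(1) cX[OF j(1)]])
      ultimately show ?thesis using j v by (intro exI[of _ j]) linarith
    qed
    then obtain j where j: "k \<le> j" "j \<le> n" "d u (c j) \<le> D + 1" by blast
    have "d (c i) (c j) \<le> d (c i) u + d u (c j)" using uX cX j i by (auto intro!: d_triangle)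
    moreover have "d (c i) u = d u (c i)" using uX cX j i by (auto intro!: d_sym)
    ultimately have "d (c i) (c j) \<le> 2 * D + 1" using i j by simp
    then have "L * (d (c i) (c j) + C) \<le> E" unfolding E_def by (intro mult_le_mono) auto
    then have "j - i \<le> E" using cu(2)[of i j] i j by simp
    then have "k - i \<le> E" using j by simp
    then have "L * (k - i) \<le> L * E" by simp
    then have "d (c i) (c k) \<le> L * E + C" using cu(1)[of i k] i k by linarith
    moreover have "d (c k) u \<le> d (c k) (c i) + d (c i) u" using uX cX k i by (auto intro!: d_triangle)
    ultimately have "d (c k) u \<le> L * E + C + D" using i j uX cX k by (simp add: d_sym)
    then show "\<exists>u\<in>?I. d (c k) u \<le> L * E + C + D" using uI by blast
  qed
qed

end

text \<open>A side of a triangle in \<open>X\<close> maps to a quasi-geodesic, which is close to an interval of \<open>Y\<close>;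
  slimness in \<open>Y\<close> leads from one side to another, and the lower bound on distances brings the
  estimate back to \<open>X\<close>.\<close>

lemma slim_pullback:
  fixes f :: "'v \<Rightarrow> 'w" and d :: "'v \<Rightarrow> 'v \<Rightarrow> nat" and d' :: "'w \<Rightarrow> 'w \<Rightarrow> nat"
  assumes "geodesic_nat_metric X d" "geodesic_nat_metric Y d'"
    and slim: "geodesic_nat_metric.slim Y d' \<delta>"
    and f: "f \<in> X \<rightarrow> Y"
    and upper: "\<And>x y. x \<in> X \<Longrightarrow> y \<in> X \<Longrightarrow> d' (f x) (f y) \<le> L * d x y + C"
    and lower: "\<And>x y. x \<in> X \<Longrightarrow> y \<in> X \<Longrightarrow> d x y \<le> L * (d' (f x) (f y) + C)"
  shows "\<exists>\<epsilon>. geodesic_nat_metric.slim X d \<epsilon>"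
proof -
  interpret X: geodesic_nat_metric X d by fact
  interpret Y: geodesic_nat_metric Y d' by fact
  obtain D where D: "\<And>n c u. Y.quasi_geodesic L C n c \<Longrightarrow> u \<in> Y.interval (c 0) (c n) \<Longrightarrow> \<exists>k\<le>n. d' u (c k) \<le> D"
    using Y.interval_near_quasi_geodesic[OF slim] by meson
  obtain R where R: "\<And>n c k. Y.quasi_geodesic L C n c \<Longrightarrow> k \<le> n \<Longrightarrow> \<exists>u\<in>Y.interval (c 0) (c n). d' (c k) u \<le> R"
    using Y.quasi_geodesic_near_interval[OF slim] by meson
  have fX: "x \<in> X \<Longrightarrow> f x \<in> Y" for x using f by auto
  have qg: "\<exists>c. Y.quasi_geodesic L C (d x y) (f \<circ> c) \<and> c 0 = x \<and> c (d x y) = y \<and> c (d x u) = u \<and>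
      (\<forall>i\<le>d x y. c i \<in> X.interval x y)"
    if xy: "x \<in> X" "y \<in> X" and u: "u \<in> X.interval x y" for x y u
  proof -
    obtain c where c: "c 0 = x" "c (d x y) = y" "c (d x u) = u"
      and ci: "\<forall>i\<le>d x y. c i \<in> X.interval x y"
      and cd: "\<forall>i j. i \<le> j \<and> j \<le> d x y \<longrightarrow> d (c i) (c j) = j - i"
      using X.ex_geodesic_through[OF xy u] by blast
    have cX: "c i \<in> X" if "i \<le> d x y" for i using ci that X.intervalD by auto
    have "Y.quasi_geodesic L C (d x y) (f \<circ> c)"
      unfolding Y.quasi_geodesic_def
    proof (intro conjI allI impI; (elim conjE)?)
      fix i assume "i \<le> d x y"
      then show "(f \<circ> c) i \<in> Y" using cX fX by auto
    next
      fix i j assume ij: "i \<le> j" "j \<le> d x y"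
      then have "d (c i) (c j) = j - i" "c i \<in> X" "c j \<in> X" using cd cX by auto
      then show "d' ((f \<circ> c) i) ((f \<circ> c) j) \<le> L * (j - i) + C"
        "j - i \<le> L * (d' ((f \<circ> c) i) ((f \<circ> c) j) + C)"
        using upper[of "c i" "c j"] lower[of "c i" "c j"] by simp_all
    qed
    then show ?thesis using c ci by blast
  qed
  have A: "\<exists>v\<in>X.interval x y. d' w (f v) \<le> D"
    if xy: "x \<in> X" "y \<in> X" and "w \<in> Y.interval (f x) (f y)" for x y w
  proof -
    obtain c where c: "Y.quasi_geodesic L C (d x y) (f \<circ> c)" "c 0 = x" "c (d x y) = y"
      "\<forall>i\<le>d x y. c i \<in> X.interval x y"
      using qg[OF xy X.interval_ends(1)[OF xy]] by blast
    then obtain k where "k \<le> d x y" "d' w ((f \<circ> c) k) \<le> D" using D[OF c(1)] \<open>w \<in> Y.interval (f x) (f y)\<close> by auto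
    then show ?thesis using c by (metis comp_apply)
  qed
  have "X.slim (L * (R + \<delta> + D + C))"
    unfolding X.slim_def
  proof (intro ballI)
    fix x y z u assume xyz: "x \<in> X" "y \<in> X" "z \<in> X" and u: "u \<in> X.interval x y"
    have uX: "u \<in> X" "d x u \<le> d x y" using X.intervalD[OF u] by auto
    obtain c where c: "Y.quasi_geodesic L C (d x y) (f \<circ> c)" "c 0 = x" "c (d x y) = y" "c (d x u) = u"
      using qg[OF xyz(1,2) u] by blast
    obtain w where w: "w \<in> Y.interval (f x) (f y)" "d' (f u) w \<le> R"
      using R[OF c(1) uX(2)] c by auto
    obtain w' where w': "w' \<in> Y.interval (f y) (f z) \<union> Y.interval (f z) (f x)" "d' w w' \<le> \<delta>"
      using slim w fX xyz unfolding Y.slim_def by blast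
    obtain v where v: "v \<in> X.interval y z \<union> X.interval z x" "d' w' (f v) \<le> D"
      using w'(1) A xyz by blast
    have YY: "w \<in> Y" "w' \<in> Y" "v \<in> X" using w w' v Y.intervalD X.intervalD by auto
    have "d' (f u) (f v) \<le> d' (f u) w + d' w (f v)" "d' w (f v) \<le> d' w w' + d' w' (f v)"
      using YY fX uX by (auto intro!: Y.d_triangle)
    then have "d' (f u) (f v) \<le> R + \<delta> + D" using w w' v by linarith
    then have "L * (d' (f u) (f v) + C) \<le> L * (R + \<delta> + D + C)" by simp
    then have "d u v \<le> L * (R + \<delta> + D + C)" using lower[OF uX(1) YY(3)] by linarith
    then show "\<exists>v\<in>X.interval y z \<union> X.interval z x. d u v \<le> L * (R + \<delta> + D + C)" using v by blast
  qed
  then show ?thesis by blast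
qed

section \<open>Graph distances\<close>

lemma graph_dist_le: "walk \<Gamma> u p v \<Longrightarrow> graph_dist \<Gamma> u v \<le> enat (length p - 1)"
  unfolding graph_dist_def by (auto intro!: INF_lower)

lemma graph_dist_attained:
  assumes "graph_dist \<Gamma> u v \<noteq> \<infinity>"
  shows "\<exists>p. walk \<Gamma> u p v \<and> enat (length p - 1) = graph_dist \<Gamma> u v"
proof -
  have "{p. walk \<Gamma> u p v} \<noteq> {}"
  proof
    assume "{p. walk \<Gamma> u p v} = {}"
    then have "graph_dist \<Gamma> u v = \<infinity>" unfolding graph_dist_def by (simp add: top_enat_def)
    then show False using assms by simp
  qed
  then have "(\<lambda>p. enat (length p - 1)) ` {p. walk \<Gamma> u p v} \<noteq> {}" by blast
  then have "Inf ((\<lambda>p. enat (length p - 1)) ` {p. walk \<Gamma> u p v}) \<in> (\<lambda>p. enat (length p - 1)) ` {p. walk \<Gamma> u p v}"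
    by (meson all_not_in_conv wellorder_InfI)
  then show ?thesis unfolding graph_dist_def by auto
qed

lemma graph_dist_le_iff:
  "graph_dist \<Gamma> u v \<le> enat n \<longleftrightarrow> (\<exists>p. walk \<Gamma> u p v \<and> length p \<le> Suc n)"
proof
  assume "graph_dist \<Gamma> u v \<le> enat n"
  moreover then obtain p where "walk \<Gamma> u p v" "enat (length p - 1) = graph_dist \<Gamma> u v"
    using graph_dist_attained by (metis enat_ord_simps(5) infinity_ileE)
  ultimately show "\<exists>p. walk \<Gamma> u p v \<and> length p \<le> Suc n"
    by (metis Suc_eq_plus1 enat_ord_simps(1) le_diff_conv)
next
  assume "\<exists>p. walk \<Gamma> u p v \<and> length p \<le> Suc n"
  then obtain p where "walk \<Gamma> u p v" "length p \<le> Suc n" by blast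
  then have "graph_dist \<Gamma> u v \<le> enat (length p - 1)" "length p - 1 \<le> n"
    using graph_dist_le by auto
  then show "graph_dist \<Gamma> u v \<le> enat n" by (meson enat_ord_simps(1) order_trans)
qed

lemma walk_append:
  assumes "walk \<Gamma> u p v" "walk \<Gamma> v p' w"
  shows "walk \<Gamma> u (p @ tl p') w"
proof (cases "tl p' = []")
  case True
  then have "p' = [v]" "w = v" using assms(2) unfolding walk_def by (cases p'; auto)+
  then show ?thesis using assms by simp
next
  case False
  then obtain y ys where p': "p' = v # y # ys"
    using assms(2) unfolding walk_def by (cases p'; cases "tl p'") auto
  then show ?thesis using assms unfolding walk_def
    by (auto simp: successively_append_iff)
qed

lemma walk_rev: "walk \<Gamma> u p v \<Longrightarrow> walk \<Gamma> v (rev p) u"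
  unfolding walk_def by (auto simp: hd_rev last_rev insert_commute)

lemma walk_split:
  assumes "walk \<Gamma> u (p1 @ x # p2) v"
  shows "walk \<Gamma> u (p1 @ [x]) x" "walk \<Gamma> x (x # p2) v"
  using assms unfolding walk_def by (auto simp: successively_append_iff hd_append split: if_splits)

lemma walk_verts: "walk \<Gamma> u p v \<Longrightarrow> u \<in> verts \<Gamma> \<and> v \<in> verts \<Gamma>"
  unfolding walk_def using hd_in_set last_in_set by blast

lemma graph_dist_triangle: "graph_dist \<Gamma> u w \<le> graph_dist \<Gamma> u v + graph_dist \<Gamma> v w"
proof (cases "graph_dist \<Gamma> u v = \<infinity> \<or> graph_dist \<Gamma> v w = \<infinity>")
  case False
  then obtain p p' where p: "walk \<Gamma> u p v" "enat (length p - 1) = graph_dist \<Gamma> u v"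
    "walk \<Gamma> v p' w" "enat (length p' - 1) = graph_dist \<Gamma> v w"
    using graph_dist_attained by meson
  then have "graph_dist \<Gamma> u w \<le> enat (length (p @ tl p') - 1)"
    by (intro graph_dist_le walk_append)
  also have "length (p @ tl p') - 1 = (length p - 1) + (length p' - 1)"
    using p unfolding walk_def by (cases p) auto
  finally show ?thesis using p by (metis plus_enat_simps(1))
qed auto

lemma graph_dist_sym: "graph_dist \<Gamma> u v = graph_dist \<Gamma> v u"
proof -
  have "graph_dist \<Gamma> u v \<le> graph_dist \<Gamma> v u" for u v
  proof (cases "graph_dist \<Gamma> v u = \<infinity>")
    case False
    then obtain p where "walk \<Gamma> v p u" "enat (length p - 1) = graph_dist \<Gamma> v u"
      using graph_dist_attained by meson
    then show ?thesis using graph_dist_le[OF walk_rev] by fastforce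
  qed auto
  then show ?thesis by (simp add: order_antisym)
qed

lemma graph_dist_refl [simp]: "u \<in> verts \<Gamma> \<Longrightarrow> graph_dist \<Gamma> u u = 0"
  using graph_dist_le[of \<Gamma> u "[u]" u] by (auto simp: walk_def enat_0)

lemma graph_dist_edge:
  "u \<in> verts \<Gamma> \<Longrightarrow> v \<in> verts \<Gamma> \<Longrightarrow> {u, v} \<in> edges \<Gamma> \<Longrightarrow> graph_dist \<Gamma> u v \<le> enat 1"
  using graph_dist_le[of \<Gamma> u "[u, v]" v] by (auto simp: walk_def)

lemma graph_dist_le_trans:
  assumes "graph_dist \<Gamma> u v \<le> enat m" "graph_dist \<Gamma> v w \<le> enat n"
  shows "graph_dist \<Gamma> u w \<le> enat (m + n)"
  using graph_dist_triangle[of \<Gamma> u w v] add_mono[OF assms] by (metis order_trans plus_enat_simps(1))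

lemma graph_dist_map_walk:
  assumes "\<And>x y. x \<in> verts \<Gamma> \<Longrightarrow> y \<in> verts \<Gamma> \<Longrightarrow> {x, y} \<in> edges \<Gamma> \<Longrightarrow> graph_dist \<Gamma>' (f x) (f y) \<le> enat K"
    and "\<And>x. x \<in> verts \<Gamma> \<Longrightarrow> f x \<in> verts \<Gamma>'"
    and "walk \<Gamma> u p v"
  shows "graph_dist \<Gamma>' (f u) (f v) \<le> enat (K * (length p - 1))"
  using assms(3)
proof (induction p arbitrary: u)
  case Nil
  then show ?case by (simp add: walk_def)
next
  case (Cons x p)
  show ?case
  proof (cases p)
    case Nil
    then have "u = v" "u \<in> verts \<Gamma>" using Cons unfolding walk_def by auto
    then show ?thesis using assms(2) by simp
  next
    case p: (Cons y p')
    have "walk \<Gamma> y p v" "x = u" "{u, y} \<in> edges \<Gamma>" "u \<in> verts \<Gamma>" "y \<in> verts \<Gamma>"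
      using Cons.prems p unfolding walk_def by auto
    then have "graph_dist \<Gamma>' (f u) (f v) \<le> enat (K + K * (length p - 1))"
      using assms(1) Cons.IH by (intro graph_dist_le_trans) auto
    then show ?thesis using p by simp
  qed
qed

text \<open>The distance is the extended one, because graphs with a deleted vertex, to which this is applied,
  may be disconnected.\<close>

lemma graph_dist_map:
  assumes "\<And>x y. x \<in> verts \<Gamma> \<Longrightarrow> y \<in> verts \<Gamma> \<Longrightarrow> {x, y} \<in> edges \<Gamma> \<Longrightarrow> graph_dist \<Gamma>' (f x) (f y) \<le> enat K"
    and "\<And>x. x \<in> verts \<Gamma> \<Longrightarrow> f x \<in> verts \<Gamma>'"
    and "graph_dist \<Gamma> u v \<le> enat n"
  shows "graph_dist \<Gamma>' (f u) (f v) \<le> enat (K * n)"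
proof -
  obtain p where p: "walk \<Gamma> u p v" "length p \<le> Suc n"
    using assms(3) unfolding graph_dist_le_iff by auto
  have "graph_dist \<Gamma>' (f u) (f v) \<le> enat (K * (length p - 1))"
    using graph_dist_map_walk[OF assms(1,2) p(1)] .
  also have "\<dots> \<le> enat (K * n)" using p by (simp add: le_diff_conv)
  finally show ?thesis .
qed

definition nat_dist :: "'v ugraph \<Rightarrow> 'v \<Rightarrow> 'v \<Rightarrow> nat" where
  "nat_dist \<Gamma> u v = the_enat (graph_dist \<Gamma> u v)"

lemma enat_nat_dist:
  assumes "connected_graph \<Gamma>" "u \<in> verts \<Gamma>" "v \<in> verts \<Gamma>"
  shows "enat (nat_dist \<Gamma> u v) = graph_dist \<Gamma> u v"
proof -
  obtain p where "walk \<Gamma> u p v" using assms unfolding connected_graph_def by blast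
  then have "graph_dist \<Gamma> u v \<noteq> \<infinity>" using graph_dist_le by (metis enat_ord_simps(5) enat_ord_code(5) infinity_ileE)
  then show ?thesis unfolding nat_dist_def by auto
qed

lemma geodesic_nat_metric_graph:
  assumes "connected_graph \<Gamma>"
  shows "geodesic_nat_metric (verts \<Gamma>) (nat_dist \<Gamma>)"
proof
  note e = enat_nat_dist[OF assms]
  fix x y assume xy: "x \<in> verts \<Gamma>" "y \<in> verts \<Gamma>"
  show zero: "nat_dist \<Gamma> x y = 0 \<longleftrightarrow> x = y"
  proof
    assume "nat_dist \<Gamma> x y = 0"
    then have "graph_dist \<Gamma> x y \<le> enat 0" using e[OF xy] by simp
    then obtain p where "walk \<Gamma> x p y" "length p \<le> Suc 0"
      unfolding graph_dist_le_iff by auto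
    then show "x = y" unfolding walk_def by (cases p) auto
  qed (use xy in \<open>simp add: nat_dist_def zero_enat_def\<close>)
  show "nat_dist \<Gamma> x y = nat_dist \<Gamma> y x" by (simp add: nat_dist_def graph_dist_sym)
  show "nat_dist \<Gamma> x z \<le> nat_dist \<Gamma> x y + nat_dist \<Gamma> y z" if "z \<in> verts \<Gamma>" for z
    using graph_dist_triangle[of \<Gamma> x z y] e[of x z, symmetric] e[of x y, symmetric] e[of y z, symmetric] xy that by simp
  assume "x \<noteq> y"
  obtain p where p: "walk \<Gamma> x p y" "length p - 1 = nat_dist \<Gamma> x y"
    using graph_dist_attained[of \<Gamma> x y] e[OF xy] by (metis enat.inject enat.distinct(2))
  then obtain z r where r: "p = x # z # r"
    using \<open>x \<noteq> y\<close> unfolding walk_def by (cases p; cases "tl p") auto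
  then have z: "walk \<Gamma> z (z # r) y" "z \<in> verts \<Gamma>" "{x, z} \<in> edges \<Gamma>"
    using p unfolding walk_def by auto
  have 1: "nat_dist \<Gamma> z y \<le> length r" using graph_dist_le[OF z(1)] e[OF z(2) xy(2), symmetric] by simp
  have 2: "nat_dist \<Gamma> x z \<le> 1" using graph_dist_edge[OF xy(1) z(2,3)] e[OF xy(1) z(2), symmetric] by simp
  have 3: "nat_dist \<Gamma> x y \<le> nat_dist \<Gamma> x z + nat_dist \<Gamma> z y"
    using graph_dist_triangle[of \<Gamma> x y z] e[OF xy, symmetric] e[OF xy(1) z(2), symmetric] e[OF z(2) xy(2), symmetric] by simp
  have "nat_dist \<Gamma> x y = Suc (length r)" using p r by simp
  then show "\<exists>z\<in>verts \<Gamma>. nat_dist \<Gamma> x z = 1 \<and> nat_dist \<Gamma> x y = Suc (nat_dist \<Gamma> z y)"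
    using 1 2 3 z by (intro bexI[of _ z]) auto
qed

lemma geodesic_imp_interval:
  assumes c: "connected_graph \<Gamma>" and p: "geodesic \<Gamma> x p y" and u: "u \<in> set p"
  shows "u \<in> geodesic_nat_metric.interval (verts \<Gamma>) (nat_dist \<Gamma>) x y"
proof -
  interpret geodesic_nat_metric "verts \<Gamma>" "nat_dist \<Gamma>" using geodesic_nat_metric_graph[OF c] .
  note e = enat_nat_dist[OF c]
  have w: "walk \<Gamma> x p y" "enat (length p - 1) = graph_dist \<Gamma> x y" using p unfolding geodesic_def by auto
  obtain p1 p2 where s: "p = p1 @ u # p2" using u by (meson split_list)
  have V: "x \<in> verts \<Gamma>" "y \<in> verts \<Gamma>" "u \<in> verts \<Gamma>" using w u unfolding walk_def by auto
  have "nat_dist \<Gamma> x u \<le> length p1"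
    using graph_dist_le[OF walk_split(1)[OF w(1)[unfolded s]]] e[OF V(1,3), symmetric] by simp
  moreover have "nat_dist \<Gamma> u y \<le> length p2"
    using graph_dist_le[OF walk_split(2)[OF w(1)[unfolded s]]] e[OF V(3,2), symmetric] by simp
  moreover have "nat_dist \<Gamma> x y = length p1 + length p2"
    using w(2) e[OF V(1,2), symmetric] s by simp
  ultimately show ?thesis using d_triangle[OF V(1,3,2)] V unfolding interval_def by auto
qed

lemma geodesic_point:
  assumes c: "connected_graph \<Gamma>" and p: "geodesic \<Gamma> x p y" and k: "k \<le> nat_dist \<Gamma> x y"
  shows "\<exists>u\<in>set p. nat_dist \<Gamma> x u = k"
proof -
  interpret geodesic_nat_metric "verts \<Gamma>" "nat_dist \<Gamma>" using geodesic_nat_metric_graph[OF c] .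
  note e = enat_nat_dist[OF c]
  have w: "walk \<Gamma> x p y" "enat (length p - 1) = graph_dist \<Gamma> x y" using p unfolding geodesic_def by auto
  have V: "x \<in> verts \<Gamma>" "y \<in> verts \<Gamma>" using walk_verts[OF w(1)] by auto
  have lp: "length p - 1 = nat_dist \<Gamma> x y" using w(2) e[OF V, symmetric] by simp
  have "p \<noteq> []" using w unfolding walk_def by auto
  then have kl: "k < length p" using k lp by (cases p) auto
  define u where "u = p ! k"
  have s: "p = take k p @ u # drop (Suc k) p" unfolding u_def using kl by (simp add: id_take_nth_drop)
  have uV: "u \<in> verts \<Gamma>" using w kl unfolding walk_def u_def by (meson nth_mem subsetD)
  have "nat_dist \<Gamma> x u \<le> k"
  proof -
    have "walk \<Gamma> x (take k p @ [u]) u" using walk_split(1) w(1) s by metis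
    then show ?thesis using graph_dist_le e[OF V(1) uV, symmetric] kl by fastforce
  qed
  moreover have "nat_dist \<Gamma> u y \<le> length p - 1 - k"
  proof -
    have "walk \<Gamma> u (u # drop (Suc k) p) y" using walk_split(2) w(1) s by metis
    then show ?thesis using graph_dist_le e[OF uV V(2), symmetric] by fastforce
  qed
  moreover have "nat_dist \<Gamma> x y \<le> nat_dist \<Gamma> x u + nat_dist \<Gamma> u y" using d_triangle V uV by blast
  ultimately have "nat_dist \<Gamma> x u = k" using lp k by linarith
  moreover have "u \<in> set p" using kl u_def by simp
  ultimately show ?thesis by blast
qed

lemma ex_geodesic_walk:
  assumes c: "connected_graph \<Gamma>" and "x \<in> verts \<Gamma>" "y \<in> verts \<Gamma>"
  shows "\<exists>p. geodesic \<Gamma> x p y"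
  using graph_dist_attained[of \<Gamma> x y] enat_nat_dist[OF assms] unfolding geodesic_def
  by (metis enat.distinct(2))

lemma ex_geodesic_walk_through:
  assumes c: "connected_graph \<Gamma>" and V: "x \<in> verts \<Gamma>" "y \<in> verts \<Gamma>"
    and u: "u \<in> geodesic_nat_metric.interval (verts \<Gamma>) (nat_dist \<Gamma>) x y"
  shows "\<exists>p. geodesic \<Gamma> x p y \<and> u \<in> set p"
proof -
  interpret geodesic_nat_metric "verts \<Gamma>" "nat_dist \<Gamma>" using geodesic_nat_metric_graph[OF c] .
  note e = enat_nat_dist[OF c]
  have u: "u \<in> verts \<Gamma>" "nat_dist \<Gamma> x u + nat_dist \<Gamma> u y = nat_dist \<Gamma> x y" using intervalD u by auto
  obtain p1 p2 where p: "geodesic \<Gamma> x p1 u" "geodesic \<Gamma> u p2 y"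
    using ex_geodesic_walk[OF c] V u by meson
  have w: "walk \<Gamma> x p1 u" "walk \<Gamma> u p2 y" using p unfolding geodesic_def by auto
  have l: "length p1 - 1 = nat_dist \<Gamma> x u" "length p2 - 1 = nat_dist \<Gamma> u y"
    using p e[OF V(1) u(1), symmetric] e[OF u(1) V(2), symmetric] unfolding geodesic_def by auto
  have ne: "p1 \<noteq> []" "last p1 = u" using w unfolding walk_def by auto
  have "length (p1 @ tl p2) - 1 = nat_dist \<Gamma> x y" using l u ne by (cases p1) auto
  then have "geodesic \<Gamma> x (p1 @ tl p2) y"
    using walk_append[OF w] e[OF V] unfolding geodesic_def by simp
  moreover have "u \<in> set (p1 @ tl p2)" using ne by auto
  ultimately show ?thesis by blast
qed

text \<open>Every point of an interval lies on some geodesic, which gives one direction. For the other one,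
  \<open>slim_thin\<close> replaces a point of an interval by a point of the prescribed geodesic side.\<close>

lemma hyperbolic_graph_iff_slim:
  assumes c: "connected_graph \<Gamma>"
  shows "hyperbolic_graph \<Gamma> \<longleftrightarrow> (\<exists>\<delta>. geodesic_nat_metric.slim (verts \<Gamma>) (nat_dist \<Gamma>) \<delta>)"
proof -
  interpret geodesic_nat_metric "verts \<Gamma>" "nat_dist \<Gamma>" using geodesic_nat_metric_graph[OF c] .
  note e = enat_nat_dist[OF c]
  show ?thesis
  proof
    assume "hyperbolic_graph \<Gamma>"
    then obtain \<delta> where \<delta>: "\<And>x y z p q r u. geodesic \<Gamma> x p y \<Longrightarrow> geodesic \<Gamma> y q z \<Longrightarrow> geodesic \<Gamma> z r x \<Longrightarrow> u \<in> set p
        \<Longrightarrow> \<exists>v\<in>set q \<union> set r. graph_dist \<Gamma> u v \<le> enat \<delta>"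
      unfolding hyperbolic_graph_def by meson
    have "slim \<delta>"
      unfolding slim_def
    proof (intro ballI)
      fix x y z u assume V: "x \<in> verts \<Gamma>" "y \<in> verts \<Gamma>" "z \<in> verts \<Gamma>" and u: "u \<in> interval x y"
      obtain p q r where g: "geodesic \<Gamma> x p y" "u \<in> set p" "geodesic \<Gamma> y q z" "geodesic \<Gamma> z r x"
        using ex_geodesic_walk_through[OF c V(1,2) u] ex_geodesic_walk[OF c] V by meson
      obtain v where v: "v \<in> set q \<union> set r" "graph_dist \<Gamma> u v \<le> enat \<delta>" using \<delta>[OF g(1,3,4,2)] by blast
      have vI: "v \<in> interval y z \<union> interval z x"
        using v(1) geodesic_imp_interval[OF c g(3)] geodesic_imp_interval[OF c g(4)] by blast
      then have "v \<in> verts \<Gamma>" using intervalD by auto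
      then have "nat_dist \<Gamma> u v \<le> \<delta>" using v(2) e[of u v, symmetric] intervalD(1)[OF u] by simp
      then show "\<exists>v\<in>interval y z \<union> interval z x. nat_dist \<Gamma> u v \<le> \<delta>" using vI by blast
    qed
    then show "\<exists>\<delta>. slim \<delta>" by blast
  next
    assume "\<exists>\<delta>. slim \<delta>"
    then obtain \<delta> where \<delta>: "slim \<delta>" by blast
    have near: "\<exists>v'\<in>set q. nat_dist \<Gamma> v v' \<le> 2 * \<delta>" if q: "geodesic \<Gamma> y q z" and v: "v \<in> interval y z" for q y z v
    proof -
      have V: "y \<in> verts \<Gamma>" "z \<in> verts \<Gamma>" using q walk_verts unfolding geodesic_def by metis+
      have "nat_dist \<Gamma> y v \<le> nat_dist \<Gamma> y z" using intervalD(2)[OF v] by simp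
      then obtain v' where v': "v' \<in> set q" "nat_dist \<Gamma> y v' = nat_dist \<Gamma> y v"
        using geodesic_point[OF c q] by blast
      then have "nat_dist \<Gamma> v v' \<le> 2 * \<delta>"
        using slim_thin[OF \<delta> V v geodesic_imp_interval[OF c q v'(1)]] by simp
      then show ?thesis using v' by blast
    qed
    have "\<exists>v\<in>set q \<union> set r. graph_dist \<Gamma> u v \<le> enat (3 * \<delta>)"
      if g: "geodesic \<Gamma> x p y" "geodesic \<Gamma> y q z" "geodesic \<Gamma> z r x" and u: "u \<in> set p" for x y z p q r u
    proof -
      have V: "x \<in> verts \<Gamma>" "y \<in> verts \<Gamma>" "z \<in> verts \<Gamma>" using g walk_verts unfolding geodesic_def by metis+
      have uI: "u \<in> interval x y" using geodesic_imp_interval[OF c g(1) u] .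
      then obtain v where v: "v \<in> interval y z \<union> interval z x" "nat_dist \<Gamma> u v \<le> \<delta>"
        using \<delta> V unfolding slim_def by blast
      then obtain v' where v': "v' \<in> set q \<union> set r" "nat_dist \<Gamma> v v' \<le> 2 * \<delta>"
        using near[OF g(2)] near[OF g(3)] by blast
      have V': "u \<in> verts \<Gamma>" "v \<in> verts \<Gamma>" using uI v intervalD by auto
      have V'': "v' \<in> verts \<Gamma>" using v' g unfolding geodesic_def walk_def by auto
      have "nat_dist \<Gamma> u v' \<le> nat_dist \<Gamma> u v + nat_dist \<Gamma> v v'" using d_triangle V' V'' by blast
      then have "nat_dist \<Gamma> u v' \<le> 3 * \<delta>" using v v' by simp
      then have "graph_dist \<Gamma> u v' \<le> enat (3 * \<delta>)" using e[OF V'(1) V'', symmetric] by simp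
      then show ?thesis using v' by blast
    qed
    then show "hyperbolic_graph \<Gamma>" unfolding hyperbolic_graph_def by blast
  qed
qed

text \<open>A map that is Lipschitz on edges and has a left inverse of the same kind up to bounded error is a
  quasi-isometric embedding.\<close>

lemma hyperbolic_graph_pullback:
  assumes con: "connected_graph \<Gamma>" "connected_graph \<Gamma>'" and hyp: "hyperbolic_graph \<Gamma>'"
    and f: "\<And>x. x \<in> verts \<Gamma> \<Longrightarrow> f x \<in> verts \<Gamma>'"
    and f_edge: "\<And>x y. x \<in> verts \<Gamma> \<Longrightarrow> y \<in> verts \<Gamma> \<Longrightarrow> {x, y} \<in> edges \<Gamma> \<Longrightarrow> graph_dist \<Gamma>' (f x) (f y) \<le> enat K"
    and b: "\<And>x. x \<in> verts \<Gamma>' \<Longrightarrow> b x \<in> verts \<Gamma>"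
    and b_edge: "\<And>x y. x \<in> verts \<Gamma>' \<Longrightarrow> y \<in> verts \<Gamma>' \<Longrightarrow> {x, y} \<in> edges \<Gamma>' \<Longrightarrow> graph_dist \<Gamma> (b x) (b y) \<le> enat K"
    and bf: "\<And>x. x \<in> verts \<Gamma> \<Longrightarrow> graph_dist \<Gamma> (b (f x)) x \<le> enat K"
  shows "hyperbolic_graph \<Gamma>"
proof -
  note e = enat_nat_dist[OF con(1)] enat_nat_dist[OF con(2)]
  obtain \<delta> where \<delta>: "geodesic_nat_metric.slim (verts \<Gamma>') (nat_dist \<Gamma>') \<delta>"
    using hyp hyperbolic_graph_iff_slim[OF con(2)] by blast
  have "\<exists>\<epsilon>. geodesic_nat_metric.slim (verts \<Gamma>) (nat_dist \<Gamma>) \<epsilon>"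
  proof (rule slim_pullback[OF geodesic_nat_metric_graph[OF con(1)] geodesic_nat_metric_graph[OF con(2)] \<delta>])
    show "f \<in> verts \<Gamma> \<rightarrow> verts \<Gamma>'" using f by auto
    fix x y assume V: "x \<in> verts \<Gamma>" "y \<in> verts \<Gamma>"
    have "graph_dist \<Gamma>' (f x) (f y) \<le> enat (K * nat_dist \<Gamma> x y)"
      using e(1)[OF V] by (intro graph_dist_map[OF f_edge f]) auto
    then have "nat_dist \<Gamma>' (f x) (f y) \<le> K * nat_dist \<Gamma> x y"
      using e(2)[OF f[OF V(1)] f[OF V(2)], symmetric] by simp
    then show "nat_dist \<Gamma>' (f x) (f y) \<le> Suc K * nat_dist \<Gamma> x y + 2 * K" by simp
    have "graph_dist \<Gamma> (b (f x)) (b (f y)) \<le> enat (K * nat_dist \<Gamma>' (f x) (f y))"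
      using e(2)[OF f[OF V(1)] f[OF V(2)]] by (intro graph_dist_map[OF b_edge b]) auto
    then have "graph_dist \<Gamma> x y \<le> enat (K + (K * nat_dist \<Gamma>' (f x) (f y) + K))"
      using bf[OF V(1)] bf[OF V(2)] by (intro graph_dist_le_trans) (auto simp: graph_dist_sym)
    then have "nat_dist \<Gamma> x y \<le> K + (K * nat_dist \<Gamma>' (f x) (f y) + K)"
      using e(1)[OF V, symmetric] by simp
    then show "nat_dist \<Gamma> x y \<le> Suc K * (nat_dist \<Gamma>' (f x) (f y) + 2 * K)" by (simp add: algebra_simps)
  qed
  then show ?thesis using hyperbolic_graph_iff_slim[OF con(1)] by blast
qed

section \<open>Word metrics\<close>

locale word_metric = group G for G :: "('a, 'm) monoid_scheme" (structure) +
  fixes S :: "'a set"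
  assumes gen: "generating_set G S"
begin

definition word :: "'a list \<Rightarrow> 'a" where
  "word w = foldr (\<otimes>) w \<one>"

definition letters :: "'a set" where
  "letters = S \<union> m_inv G ` S"

abbreviation dist :: "'a \<Rightarrow> 'a \<Rightarrow> real" where
  "dist \<equiv> word_dist G S"

definition norm :: "'a \<Rightarrow> nat" where
  "norm g = (LEAST n. \<exists>w\<in>lists letters. length w = n \<and> word w = g)"

lemma dist_norm: "dist g h = real (norm (inv g \<otimes> h))"
  unfolding word_dist_def norm_def word_def letters_def by simp

lemma S_subset: "S \<subseteq> carrier G" and gen_eq: "generate G S = carrier G"
  using gen unfolding generating_set_def by auto

lemma letters_closed: "letters \<subseteq> carrier G"
  unfolding letters_def using S_subset by auto

lemma letters_inv: "x \<in> letters \<Longrightarrow> inv x \<in> letters"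
  unfolding letters_def using S_subset by (auto simp: subset_iff)

lemma word_closed: "w \<in> lists letters \<Longrightarrow> word w \<in> carrier G"
  unfolding word_def using letters_closed by (induction w) auto

lemma word_simps [simp]: "word [] = \<one>" "word (x # w) = x \<otimes> word w"
  by (simp_all add: word_def)

lemma word_append:
  "v \<in> lists letters \<Longrightarrow> w \<in> lists letters \<Longrightarrow> word (v @ w) = word v \<otimes> word w"
proof (induction v)
  case Nil
  then show ?case using word_closed by simp
next
  case (Cons x v)
  then show ?case using word_closed letters_closed by (simp add: m_assoc subset_iff)
qed

lemma word_inverse:
  "w \<in> lists letters \<Longrightarrow> word (rev (map (m_inv G) w)) = inv (word w)"
proof (induction w)
  case Nil
  then show ?case by simp
next
  case (Cons x w)
  then have x: "x \<in> letters" "inv x \<in> letters" "w \<in> lists letters" using letters_inv by auto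
  then have "x \<in> carrier G" "rev (map (m_inv G) w) \<in> lists letters" using letters_closed letters_inv by auto
  then have "word (rev (map (m_inv G) w) @ [inv x]) = word (rev (map (m_inv G) w)) \<otimes> word [inv x]"
    using x by (intro word_append) auto
  then show ?case using Cons x \<open>x \<in> carrier G\<close> word_closed by (simp add: inv_mult_group)
qed

lemma ex_word: "g \<in> carrier G \<Longrightarrow> \<exists>w\<in>lists letters. word w = g"
proof -
  assume "g \<in> carrier G"
  then have "g \<in> generate G S" using gen_eq by simp
  then show ?thesis
  proof (induction rule: generate.induct)
    case one
    then show ?case by (intro bexI[of _ "[]"]) auto
  next
    case (incl h)
    then show ?case using S_subset by (intro bexI[of _ "[h]"]) (auto simp: letters_def)
  next
    case (inv h)
    then show ?case using S_subset by (intro bexI[of _ "[inv h]"]) (auto simp: letters_def)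
  next
    case (eng h1 h2)
    then obtain v w where "v \<in> lists letters" "w \<in> lists letters" "word v = h1" "word w = h2" by blast
    then show ?case using word_append by (intro bexI[of _ "v @ w"]) auto
  qed
qed

lemma norm_attained:
  assumes "g \<in> carrier G"
  shows "\<exists>w\<in>lists letters. length w = norm g \<and> word w = g"
  unfolding norm_def by (rule LeastI_ex) (use ex_word[OF assms] in blast)

lemma norm_le: "w \<in> lists letters \<Longrightarrow> word w = g \<Longrightarrow> norm g \<le> length w"
  unfolding norm_def by (rule Least_le) blast

lemma norm_mult:
  assumes "g \<in> carrier G" "h \<in> carrier G"
  shows "norm (g \<otimes> h) \<le> norm g + norm h"
proof -
  obtain v w where "v \<in> lists letters" "w \<in> lists letters" "word v = g" "word w = h"
    "length v = norm g" "length w = norm h"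
    using norm_attained assms by meson
  then show ?thesis using norm_le[of "v @ w" "g \<otimes> h"] word_append by auto
qed

lemma norm_inv_le:
  assumes "g \<in> carrier G"
  shows "norm (inv g) \<le> norm g"
proof -
  obtain w where w: "w \<in> lists letters" "word w = g" "length w = norm g"
    using norm_attained assms by meson
  have "rev (map (m_inv G) w) \<in> lists letters" using w letters_inv by auto
  then show ?thesis using norm_le[of "rev (map (m_inv G) w)" "inv g"] word_inverse w by auto
qed

lemma norm_inv: "g \<in> carrier G \<Longrightarrow> norm (inv g) = norm g"
  using norm_inv_le[of g] norm_inv_le[of "inv g"] by simp

lemma dist_nonneg [simp]: "0 \<le> dist g h"
  by (simp add: dist_norm)

lemma dist_self [simp]: "g \<in> carrier G \<Longrightarrow> dist g g = 0"
  using norm_le[of "[]" \<one>] by (simp add: dist_norm)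

lemma dist_sym: "g \<in> carrier G \<Longrightarrow> h \<in> carrier G \<Longrightarrow> dist g h = dist h g"
  using norm_inv[of "inv g \<otimes> h"] by (simp add: dist_norm inv_mult_group)

lemma dist_triangle:
  assumes "g \<in> carrier G" "h \<in> carrier G" "k \<in> carrier G"
  shows "dist g k \<le> dist g h + dist h k"
proof -
  have "h \<otimes> (inv h \<otimes> k) = k"
    using assms by (simp add: m_assoc[symmetric])
  then have "inv g \<otimes> h \<otimes> (inv h \<otimes> k) = inv g \<otimes> k"
    using assms by (simp add: m_assoc)
  then show ?thesis using norm_mult[of "inv g \<otimes> h" "inv h \<otimes> k"] assms by (simp add: dist_norm)
qed

lemma dist_left:
  assumes "k \<in> carrier G" "g \<in> carrier G" "h \<in> carrier G"
  shows "dist (k \<otimes> g) (k \<otimes> h) = dist g h"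
proof -
  have "inv k \<otimes> (k \<otimes> h) = h" using assms by (simp add: m_assoc[symmetric])
  then have "inv (k \<otimes> g) \<otimes> (k \<otimes> h) = inv g \<otimes> h"
    using assms by (simp add: inv_mult_group m_assoc)
  then show ?thesis by (simp add: dist_norm)
qed

lemma dist_mult_right:
  assumes "g \<in> carrier G" "h \<in> carrier G"
  shows "dist g (g \<otimes> h) = dist \<one> h"
  using dist_left[of g \<one> h] assms by simp

lemma dist_generator:
  assumes "g \<in> carrier G" "s \<in> S"
  shows "dist g (g \<otimes> s) \<le> 1"
proof -
  have "s \<in> carrier G" "s \<in> letters" using assms S_subset by (auto simp: letters_def)
  then show ?thesis using norm_le[of "[s]" s] dist_mult_right[OF assms(1)] by (simp add: dist_norm)
qed

lemma finite_ball:
  assumes "finite S" "g \<in> carrier G"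
  shows "finite {h \<in> carrier G. dist g h \<le> r}"
proof -
  have "finite letters" using assms unfolding letters_def by simp
  then have fin: "finite {w. set w \<subseteq> letters \<and> length w \<le> nat \<lfloor>r\<rfloor>}" by (rule finite_lists_length_le)
  have "{h \<in> carrier G. dist g h \<le> r} \<subseteq> (\<lambda>w. g \<otimes> word w) ` {w. set w \<subseteq> letters \<and> length w \<le> nat \<lfloor>r\<rfloor>}"
  proof
    fix h assume h: "h \<in> {h \<in> carrier G. dist g h \<le> r}"
    then have "inv g \<otimes> h \<in> carrier G" using assms by simp
    then obtain w where w: "w \<in> lists letters" "length w = norm (inv g \<otimes> h)" "word w = inv g \<otimes> h"
      using norm_attained by blast
    have "g \<otimes> word w = h" using h w assms by (simp add: m_assoc[symmetric])
    moreover have "length w \<le> nat \<lfloor>r\<rfloor>" using h w by (simp add: dist_norm le_nat_floor)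
    ultimately show "h \<in> (\<lambda>w. g \<otimes> word w) ` {w. set w \<subseteq> letters \<and> length w \<le> nat \<lfloor>r\<rfloor>}" using w
      by (intro image_eqI[of _ _ w]) auto
  qed
  then show ?thesis using fin finite_surj by blast
qed

text \<open>The finitely many letters of \<open>A\<close> have bounded length in the letters of \<open>S\<close>. The set \<open>S\<close> may be
  infinite, so there need not be an inequality in the other direction.\<close>

lemma dist_le_finite_generating:
  assumes "finite A" "generating_set G A"
  shows "\<exists>c::nat. \<forall>g\<in>carrier G. \<forall>h\<in>carrier G. dist g h \<le> real c * word_dist G A g h"
proof -
  interpret A: word_metric G A using assms by unfold_locales
  have finL: "finite A.letters" using assms unfolding A.letters_def by simp
  define c where "c = Max (insert 0 (norm ` A.letters))"
  have c: "norm x \<le> c" if "x \<in> A.letters" for x unfolding c_def using that finL by (intro Max_ge) auto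
  have *: "norm (A.word w) \<le> c * length w" if "w \<in> lists A.letters" for w
    using that
  proof (induction w)
    case Nil
    then show ?case using norm_le[of "[]" \<one>] by simp
  next
    case (Cons x w)
    then have "norm (x \<otimes> A.word w) \<le> norm x + norm (A.word w)"
      using A.letters_closed A.word_closed by (intro norm_mult) auto
    then show ?case using Cons c[of x] by simp
  qed
  show ?thesis
  proof (intro exI[of _ c] ballI)
    fix g h assume gh: "g \<in> carrier G" "h \<in> carrier G"
    then obtain w where w: "w \<in> lists A.letters" "length w = A.norm (inv g \<otimes> h)" "A.word w = inv g \<otimes> h"
      using A.norm_attained[of "inv g \<otimes> h"] by auto
    then have "norm (inv g \<otimes> h) \<le> c * A.norm (inv g \<otimes> h)" using *[of w] by simp
    then show "dist g h \<le> real c * word_dist G A g h"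
      unfolding dist_norm A.dist_norm by (metis of_nat_le_iff of_nat_mult)
  qed
qed

text \<open>Stated for any graph that contains the Cayley graph, so that it applies to coned-off graphs before
  and after the deletion of a cone vertex.\<close>

lemma graph_dist_le_dist:
  assumes "Inl ` carrier G \<subseteq> verts \<Gamma>"
    and "\<And>g s. g \<in> carrier G \<Longrightarrow> s \<in> S \<Longrightarrow> {Inl g, Inl (g \<otimes> s)} \<in> edges \<Gamma>"
    and "g \<in> carrier G" "h \<in> carrier G" "dist g h \<le> real n"
  shows "graph_dist \<Gamma> (Inl g) (Inl h) \<le> enat n"
proof -
  have V: "Inl x \<in> verts \<Gamma>" if "x \<in> carrier G" for x using assms(1) that by auto
  have edge: "graph_dist \<Gamma> (Inl x) (Inl (x \<otimes> s)) \<le> enat 1" if x: "x \<in> carrier G" and s: "s \<in> letters" for x s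
  proof -
    have sc: "s \<in> carrier G" using s letters_closed by auto
    show ?thesis
    proof (cases "s \<in> S")
      case True
      then show ?thesis using assms(2)[OF x] V sc x by (intro graph_dist_edge) auto
    next
      case False
      then obtain t where t: "t \<in> S" "s = inv t" using s unfolding letters_def by auto
      then have tc: "t \<in> carrier G" using S_subset by auto
      then have "x \<otimes> s \<otimes> t = x" using t x by (simp add: m_assoc)
      then have "{Inl (x \<otimes> s), Inl x} \<in> edges \<Gamma>" using assms(2)[of "x \<otimes> s" t] t x sc by auto
      then show ?thesis using V x sc by (intro graph_dist_edge) (auto simp: insert_commute)
    qed
  qed
  have path: "graph_dist \<Gamma> (Inl x) (Inl (x \<otimes> word w)) \<le> enat (length w)"
    if "w \<in> lists letters" "x \<in> carrier G" for w x
    using that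
  proof (induction w arbitrary: x)
    case Nil
    then show ?case using V by (simp add: enat_0)
  next
    case (Cons s w)
    have sc: "s \<in> carrier G" "word w \<in> carrier G" using Cons letters_closed word_closed by auto
    have "graph_dist \<Gamma> (Inl x) (Inl (x \<otimes> s \<otimes> word w)) \<le> enat (1 + length w)"
      using Cons edge sc by (intro graph_dist_le_trans[of _ _ "Inl (x \<otimes> s)"]) auto
    then show ?case using Cons sc by (simp add: m_assoc)
  qed
  obtain w where w: "w \<in> lists letters" "length w = norm (inv g \<otimes> h)" "word w = inv g \<otimes> h"
    using norm_attained[of "inv g \<otimes> h"] assms by auto
  have "g \<otimes> word w = h" using w assms by (simp add: m_assoc[symmetric])
  moreover have "length w \<le> n" using w assms(5) by (simp add: dist_norm)
  ultimately show ?thesis using path[OF w(1) assms(3)] by (metis enat_ord_simps(1) order_trans)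
qed

end

section \<open>Subsets at finite Hausdorff distance\<close>

text \<open>Hausdorff distance at most \<open>r\<close>, witnessed by points instead of infima; the next two lemmas
  give the comparison.\<close>

definition close_sets :: "('a \<Rightarrow> 'a \<Rightarrow> real) \<Rightarrow> real \<Rightarrow> 'a set \<Rightarrow> 'a set \<Rightarrow> bool" where
  "close_sets d r X Y \<longleftrightarrow> (\<forall>x\<in>X. \<exists>y\<in>Y. d x y \<le> r) \<and> (\<forall>y\<in>Y. \<exists>x\<in>X. d x y \<le> r)"

lemma close_setsI_hausdorff:
  assumes "hausdorff_dist d X Y < ereal M"
  shows "close_sets d M X Y"
proof -
  have 1: "(SUP a\<in>X. INF b\<in>Y. ereal (d a b)) < ereal M" "(SUP b\<in>Y. INF a\<in>X. ereal (d a b)) < ereal M"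
    using assms unfolding hausdorff_dist_def by simp_all
  have "\<exists>b\<in>Y. d a b \<le> M" if "a \<in> X" for a
  proof -
    have "(INF b\<in>Y. ereal (d a b)) < ereal M"
      using 1(1) SUP_upper[OF that, of "\<lambda>a. INF b\<in>Y. ereal (d a b)"] by (rule le_less_trans[rotated])
    then show ?thesis unfolding INF_less_iff by (auto intro: less_imp_le)
  qed
  moreover have "\<exists>a\<in>X. d a b \<le> M" if "b \<in> Y" for b
  proof -
    have "(INF a\<in>X. ereal (d a b)) < ereal M"
      using 1(2) SUP_upper[OF that, of "\<lambda>b. INF a\<in>X. ereal (d a b)"] by (rule le_less_trans[rotated])
    then show ?thesis unfolding INF_less_iff by (auto intro: less_imp_le)
  qed
  ultimately show ?thesis unfolding close_sets_def by blast
qed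

lemma hausdorff_le_close_sets:
  assumes "close_sets d r X Y"
  shows "hausdorff_dist d X Y \<le> ereal r"
  unfolding hausdorff_dist_def
proof (intro max.boundedI SUP_least)
  fix a assume "a \<in> X"
  then obtain b where b: "b \<in> Y" "d a b \<le> r" using assms unfolding close_sets_def by blast
  have "(INF b\<in>Y. ereal (d a b)) \<le> ereal (d a b)" using b by (intro INF_lower)
  also have "\<dots> \<le> ereal r" using b by simp
  finally show "(INF b\<in>Y. ereal (d a b)) \<le> ereal r" .
next
  fix b assume "b \<in> Y"
  then obtain a where a: "a \<in> X" "d a b \<le> r" using assms unfolding close_sets_def by blast
  have "(INF a\<in>X. ereal (d a b)) \<le> ereal (d a b)" using a by (intro INF_lower)
  also have "\<dots> \<le> ereal r" using a by simp
  finally show "(INF a\<in>X. ereal (d a b)) \<le> ereal r" .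
qed

lemma close_sets_mono: "close_sets d r X Y \<Longrightarrow> r \<le> s \<Longrightarrow> close_sets d s X Y"
  unfolding close_sets_def by (meson order_trans)

context word_metric
begin

lemma close_refl: "X \<subseteq> carrier G \<Longrightarrow> 0 \<le> r \<Longrightarrow> close_sets dist r X X"
  unfolding close_sets_def using dist_self by (metis subsetD)

lemma close_sym:
  assumes "X \<subseteq> carrier G" "Y \<subseteq> carrier G" "close_sets dist r X Y"
  shows "close_sets dist r Y X"
  using assms unfolding close_sets_def by (metis dist_sym subsetD)

lemma close_trans:
  assumes "X \<subseteq> carrier G" "Y \<subseteq> carrier G" "Z \<subseteq> carrier G"
    and "close_sets dist r X Y" "close_sets dist s Y Z"
  shows "close_sets dist (r + s) X Z"
proof -
  have t: "dist x z \<le> r + s" if "x \<in> X" "y \<in> Y" "z \<in> Z" "dist x y \<le> r" "dist y z \<le> s" for x y z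
    using dist_triangle[of x y z] that assms(1-3) by (auto simp: subset_iff)
  show ?thesis using assms(4,5) t unfolding close_sets_def by meson
qed

lemma close_left:
  assumes "X \<subseteq> carrier G" "Y \<subseteq> carrier G" "g \<in> carrier G" "close_sets dist r X Y"
  shows "close_sets dist r (g <# X) (g <# Y)"
  using assms unfolding close_sets_def l_coset_def
  by (fastforce simp: dist_left subset_iff)

text \<open>The bound \<open>r\<close> may depend on \<open>g\<close>: this is what makes the set closed under products.\<close>

definition coarse_stabiliser :: "'a set \<Rightarrow> 'a set" where
  "coarse_stabiliser U = {g \<in> carrier G. \<exists>r. close_sets dist r (g <# U) U}"

lemma subgroup_coarse_stabiliser:
  assumes U: "U \<subseteq> carrier G"
  shows "subgroup (coarse_stabiliser U) G"
proof
  show "coarse_stabiliser U \<subseteq> carrier G" unfolding coarse_stabiliser_def by auto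
  have "\<one> <# U = U" using U by (force simp: l_coset_def)
  then show "\<one> \<in> coarse_stabiliser U" unfolding coarse_stabiliser_def using close_refl[OF U, of 0] by auto
next
  fix x y assume "x \<in> coarse_stabiliser U" "y \<in> coarse_stabiliser U"
  then obtain r s where xy: "x \<in> carrier G" "y \<in> carrier G" "close_sets dist r (x <# U) U" "close_sets dist s (y <# U) U"
    unfolding coarse_stabiliser_def by auto
  have "close_sets dist s (x <# (y <# U)) (x <# U)"
    using xy U by (intro close_left l_coset_subset_G)
  then have "close_sets dist (s + r) ((x \<otimes> y) <# U) U"
    using xy U close_trans[of "(x \<otimes> y) <# U" "x <# U" U s r]
    by (simp add: lcos_m_assoc l_coset_subset_G)
  then show "x \<otimes> y \<in> coarse_stabiliser U" unfolding coarse_stabiliser_def using xy by auto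
next
  fix x assume "x \<in> coarse_stabiliser U"
  then obtain r where x: "x \<in> carrier G" "close_sets dist r (x <# U) U"
    unfolding coarse_stabiliser_def by auto
  have "close_sets dist r (inv x <# (x <# U)) (inv x <# U)"
    using x U by (intro close_left l_coset_subset_G) auto
  moreover have "inv x <# (x <# U) = U" using x U by (simp add: lcos_m_assoc lcos_mult_one)
  ultimately have "close_sets dist r (inv x <# U) U"
    using close_sym U x l_coset_subset_G by (metis inv_closed)
  then show "inv x \<in> coarse_stabiliser U" unfolding coarse_stabiliser_def using x by auto
qed

end

text \<open>Modelled on the images of cosets of \<open>H\<close> under a quasi-inverse. One constant \<open>M\<close> serves for
  two axioms, since it can be enlarged.\<close>

locale coarsely_permuted = word_metric +
  fixes \<U> :: "'a set set" and M :: real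
  assumes subsets: "U \<in> \<U> \<Longrightarrow> U \<subseteq> carrier G" and nonempty: "U \<in> \<U> \<Longrightarrow> U \<noteq> {}"
    and permuted: "\<lbrakk>g \<in> carrier G; U \<in> \<U>\<rbrakk> \<Longrightarrow> \<exists>V\<in>\<U>. close_sets dist M (g <# U) V"
    and locally_finite: "finite {U \<in> \<U>. \<exists>u\<in>U. dist \<one> u \<le> r}"
    and bounded: "\<lbrakk>U \<in> \<U>; V \<in> \<U>; close_sets dist r U V\<rbrakk> \<Longrightarrow> close_sets dist M U V"
begin

lemma translate_near_one:
  assumes "U \<in> \<U>" "u \<in> U"
  shows "\<exists>V\<in>\<U>. close_sets dist M (inv u <# U) V \<and> (\<exists>v\<in>V. dist \<one> v \<le> M)"
proof -
  have u: "u \<in> carrier G" using assms(2) subsets[OF assms(1)] by auto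
  obtain V where V: "V \<in> \<U>" "close_sets dist M (inv u <# U) V" using permuted[of "inv u" U] assms u by auto
  have "\<one> \<in> inv u <# U" unfolding l_coset_def using assms u by force
  then show ?thesis using V unfolding close_sets_def by blast
qed

lemma M_nonneg: "U \<in> \<U> \<Longrightarrow> 0 \<le> M"
proof -
  assume U: "U \<in> \<U>"
  then obtain u where "u \<in> U" using nonempty by blast
  then obtain v where "dist \<one> v \<le> M" using translate_near_one[OF U] by blast
  then show ?thesis using dist_nonneg[of \<one> v] by linarith
qed

text \<open>For \<open>u \<in> U\<close>, the translate of \<open>U\<close> by \<open>inv u\<close> contains \<open>\<one>\<close>, so it is close to one of the finitely many
  members of the family that pass near \<open>\<one>\<close>. If the translates by \<open>inv u\<close> and \<open>inv t\<close> are close to the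
  same member, then \<open>u \<otimes> inv t\<close> coarsely stabilises \<open>U\<close>; choosing one \<open>t\<close> for each member shows
  that every \<open>u\<close> is at bounded distance from the stabiliser. Conversely, if \<open>k\<close> is in the
  stabiliser, then the translate of \<open>U\<close> by \<open>k\<close> is uniformly close to \<open>U\<close> by the last axiom of the
  locale, and it contains a point at a fixed distance from \<open>k\<close>.\<close>

lemma close_coarse_stabiliser:
  assumes U: "U \<in> \<U>"
  shows "\<exists>r. close_sets dist r (coarse_stabiliser U) U"
proof -
  note [simp] = subsets[OF U] l_coset_subset_G
  define F where "F = {V \<in> \<U>. \<exists>v\<in>V. dist \<one> v \<le> M}"
  have finF: "finite F" unfolding F_def by (rule locally_finite)
  define t where "t V = (SOME u. u \<in> U \<and> close_sets dist M (inv u <# U) V)" for V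
  define D where "D = Max (insert 0 ((\<lambda>V. dist \<one> (t V)) ` F))"
  have D: "dist \<one> (t V) \<le> D" if "V \<in> F" for V unfolding D_def using that finF by (intro Max_ge) auto
  have 1: "\<exists>k\<in>coarse_stabiliser U. dist k u \<le> D" if u: "u \<in> U" for u
  proof -
    have uc: "u \<in> carrier G" using u subsets[OF U] by blast
    obtain V where V: "V \<in> F" "V \<in> \<U>" "close_sets dist M (inv u <# U) V"
      using translate_near_one[OF U u] unfolding F_def by blast
    then have "t V \<in> U \<and> close_sets dist M (inv t V <# U) V"
      unfolding t_def using u by (intro someI[of "\<lambda>u. u \<in> U \<and> close_sets dist M (inv u <# U) V" u]) auto
    then have t: "t V \<in> carrier G" "close_sets dist M (inv t V <# U) V" using subsets[OF U] by blast+
    have "close_sets dist (M + M) (inv t V <# U) (inv u <# U)"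
      using t V uc subsets[OF V(2)]
      by (intro close_trans[of _ V] close_sym[of _ V] l_coset_subset_G) auto
    then have "close_sets dist (M + M) (u <# (inv t V <# U)) (u <# (inv u <# U))"
      using t uc by (intro close_left l_coset_subset_G) auto
    moreover have "u <# (inv u <# U) = U" "u <# (inv t V <# U) = (u \<otimes> inv t V) <# U"
      using uc t by (simp_all add: lcos_m_assoc lcos_mult_one)
    ultimately have k: "u \<otimes> inv t V \<in> coarse_stabiliser U"
      unfolding coarse_stabiliser_def using uc t by auto
    have "u \<otimes> inv t V \<otimes> t V = u" using uc t by (simp add: m_assoc)
    then have "dist (u \<otimes> inv t V) u = dist \<one> (t V)"
      using dist_mult_right[of "u \<otimes> inv t V" "t V"] uc t by simp
    then show ?thesis using k D[OF V(1)] by metis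
  qed
  obtain u0 where u0: "u0 \<in> U" using nonempty[OF U] by blast
  then have u0c: "u0 \<in> carrier G" using subsets[OF U] by blast
  have 2: "\<exists>u\<in>U. dist k u \<le> dist \<one> u0 + (M + M)" if k: "k \<in> coarse_stabiliser U" for k
  proof -
    obtain r where kr: "k \<in> carrier G" "close_sets dist r (k <# U) U" using k unfolding coarse_stabiliser_def by auto
    obtain V where V: "V \<in> \<U>" "close_sets dist M (k <# U) V" using permuted[OF kr(1) U] by blast
    have kU: "k <# U \<subseteq> carrier G" using kr by (simp add: l_coset_subset_G)
    have "close_sets dist (M + r) V U"
      using kr V subsets[OF V(1)] kU by (intro close_trans[of V "k <# U" U] close_sym[of "k <# U" V]) auto
    then have "close_sets dist M V U" using bounded V(1) U by blast
    then have "close_sets dist (M + M) (k <# U) U"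
      using kU V subsets[OF V(1)] by (intro close_trans[of _ V]) auto
    moreover have "k \<otimes> u0 \<in> k <# U" using u0 unfolding l_coset_def by auto
    ultimately obtain u where u: "u \<in> U" "dist (k \<otimes> u0) u \<le> M + M" unfolding close_sets_def by blast
    have "dist k u \<le> dist k (k \<otimes> u0) + dist (k \<otimes> u0) u"
      using u u0c kr subsets[OF U] by (intro dist_triangle) blast+
    then show ?thesis using u dist_mult_right[OF kr(1) u0c] by (intro bexI[of _ u]) auto
  qed
  show ?thesis
    unfolding close_sets_def using 1 2
    by (intro exI[of _ "max D (dist \<one> u0 + (M + M))"]) (meson max.coboundedI1 max.coboundedI2)
qed

definition orbit_related :: "'a set \<Rightarrow> 'a set \<Rightarrow> bool" where
  "orbit_related U V \<longleftrightarrow> (\<exists>g\<in>carrier G. \<exists>r. close_sets dist r (g <# U) V)"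

lemma orbit_related_sym:
  assumes "U \<in> \<U>" "V \<in> \<U>" "orbit_related U V"
  shows "orbit_related V U"
proof -
  note UV = subsets[OF assms(1)] subsets[OF assms(2)]
  obtain g r where g: "g \<in> carrier G" "close_sets dist r (g <# U) V" using assms unfolding orbit_related_def by auto
  have "close_sets dist r (inv g <# (g <# U)) (inv g <# V)"
    using g UV by (intro close_left l_coset_subset_G) auto
  moreover have "inv g <# (g <# U) = U" using g UV by (simp add: lcos_m_assoc lcos_mult_one)
  ultimately have "close_sets dist r (inv g <# V) U"
    using close_sym[OF UV(1) l_coset_subset_G[OF UV(2)]] g by simp
  then show ?thesis unfolding orbit_related_def using g by auto
qed

lemma orbit_related_trans:
  assumes "U \<in> \<U>" "V \<in> \<U>" "W \<in> \<U>" "orbit_related U V" "orbit_related V W"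
  shows "orbit_related U W"
proof -
  note UV = subsets[OF assms(1)] subsets[OF assms(2)] subsets[OF assms(3)]
  obtain g r h s where g: "g \<in> carrier G" "close_sets dist r (g <# U) V"
    "h \<in> carrier G" "close_sets dist s (h <# V) W" using assms unfolding orbit_related_def by auto
  have "close_sets dist r (h <# (g <# U)) (h <# V)"
    using g UV by (intro close_left l_coset_subset_G) auto
  moreover have "h <# (g <# U) = (h \<otimes> g) <# U" using g UV by (simp add: lcos_m_assoc)
  ultimately have "close_sets dist (r + s) ((h \<otimes> g) <# U) W"
    using g UV l_coset_subset_G by (intro close_trans[of _ "h <# V"]) auto
  then show ?thesis unfolding orbit_related_def using g by auto
qed

text \<open>Every orbit has a representative near \<open>\<one>\<close>, hence there are finitely many. One representative for
  each orbit has to be chosen: the stabilisers of two members of the same orbit are conjugate, so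
  they may have distinct cosets at finite Hausdorff distance.\<close>

lemma ex_stabiliser_collection:
  "\<exists>\<P> D. finite \<P> \<and> (\<forall>P\<in>\<P>. subgroup P G) \<and>
     (\<forall>W\<in>all_lcosets G \<P>. \<exists>U\<in>\<U>. close_sets dist D W U) \<and>
     (\<forall>U\<in>\<U>. \<exists>W\<in>all_lcosets G \<P>. close_sets dist D W U) \<and>
     (\<forall>W\<in>all_lcosets G \<P>. \<forall>W'\<in>all_lcosets G \<P>. \<forall>r. close_sets dist r W W' \<longrightarrow> W = W')"
proof -
  define F where "F = {V \<in> \<U>. \<exists>v\<in>V. dist \<one> v \<le> M}"
  have finF: "finite F" unfolding F_def by (rule locally_finite)
  \<comment> \<open>Members of the same orbit satisfy the same predicate below, so \<open>SOME\<close> selects the same representative.\<close>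
  define rep where "rep U = (SOME V. V \<in> F \<and> orbit_related U V)" for U
  have rep: "rep U \<in> F \<and> orbit_related U (rep U)" if U: "U \<in> \<U>" for U
  proof -
    obtain u where u: "u \<in> U" using nonempty U by blast
    then have "inv u \<in> carrier G" using subsets[OF U] by auto
    then have "\<exists>V. V \<in> F \<and> orbit_related U V"
      using translate_near_one[OF U u] unfolding F_def orbit_related_def by blast
    then show ?thesis unfolding rep_def by (rule someI_ex)
  qed
  have rep_eq: "rep U = rep V" if UV: "U \<in> \<U>" "V \<in> \<U>" "orbit_related U V" for U V
  proof -
    have "orbit_related U W \<longleftrightarrow> orbit_related V W" if "W \<in> F" for W
      using that UV orbit_related_trans orbit_related_sym unfolding F_def by blast
    then have "(\<lambda>W. W \<in> F \<and> orbit_related U W) = (\<lambda>W. W \<in> F \<and> orbit_related V W)" by blast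
    then show ?thesis unfolding rep_def by simp
  qed
  define R where "R = rep ` F"
  have RU: "R \<subseteq> \<U>" using rep unfolding R_def F_def by auto
  have rep_rep: "rep U = U" if U: "U \<in> R" for U
  proof -
    obtain V where V: "V \<in> F" "U = rep V" using U unfolding R_def by auto
    then have "V \<in> \<U>" unfolding F_def by auto
    moreover have "U \<in> \<U>" using RU U by auto
    moreover have "orbit_related V U" using rep[OF calculation(1)] V by simp
    ultimately have "rep V = rep U" by (rule rep_eq)
    then show ?thesis using V by simp
  qed
  have R_rep: "rep U \<in> R" if U: "U \<in> \<U>" for U
  proof -
    have r: "rep U \<in> F" "orbit_related U (rep U)" using rep[OF U] by auto
    then have "rep U \<in> \<U>" unfolding F_def by auto
    from rep_eq[OF U this r(2)] show ?thesis unfolding R_def using r(1) by (rule image_eqI)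
  qed
  obtain \<rho> where \<rho>: "\<And>U. U \<in> \<U> \<Longrightarrow> close_sets dist (\<rho> U) (coarse_stabiliser U) U"
    using close_coarse_stabiliser by metis
  define D where "D = Max (insert 0 (\<rho> ` R))"
  have finR: "finite R" unfolding R_def using finF by simp
  have D: "close_sets dist D (coarse_stabiliser U) U" if "U \<in> R" for U
    using \<rho>[of U] that RU finR by (intro close_sets_mono[of _ "\<rho> U" _ _ D]) (auto simp: D_def)
  define \<P> where "\<P> = coarse_stabiliser ` R"
  have sub: "coarse_stabiliser U \<subseteq> carrier G" for U unfolding coarse_stabiliser_def by auto
  have coset: "W \<in> all_lcosets G \<P> \<longleftrightarrow> (\<exists>U\<in>R. \<exists>g\<in>carrier G. W = g <# coarse_stabiliser U)" for W
    unfolding all_lcosets_def LCOSETS_def \<P>_def by auto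
  have gD: "close_sets dist D (g <# coarse_stabiliser U) (g <# U)" if "U \<in> R" "g \<in> carrier G" for g U
    using that D subsets RU sub by (intro close_left) auto
  have c: "g <# U \<subseteq> carrier G" if "g \<in> carrier G" "U \<subseteq> carrier G" for g U
    using that by (simp add: l_coset_subset_G)
  have 1: "\<exists>U\<in>\<U>. close_sets dist (D + (M + M)) W U" if W: "W \<in> all_lcosets G \<P>" for W
  proof -
    obtain U g where U: "U \<in> R" "g \<in> carrier G" "W = g <# coarse_stabiliser U" using W coset by auto
    obtain V where V: "V \<in> \<U>" "close_sets dist M (g <# U) V" using permuted[OF U(2), of U] U RU by auto
    have "U \<in> \<U>" using U RU by auto
    have "close_sets dist (D + M) W V"
      using gD[OF U(1,2)] U V c[OF U(2)] sub subsets[OF V(1)] subsets[OF \<open>U \<in> \<U>\<close>] by (intro close_trans[of _ "g <# U"]) auto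
    then have "close_sets dist (D + (M + M)) W V"
      by (rule close_sets_mono) (use M_nonneg[OF V(1)] in simp)
    then show ?thesis using V by blast
  qed
  have 2: "\<exists>W\<in>all_lcosets G \<P>. close_sets dist (D + (M + M)) W V" if V: "V \<in> \<U>" for V
  proof -
    define U where "U = rep V"
    have U: "U \<in> R" "U \<in> \<U>" using R_rep[OF V] RU unfolding U_def by auto
    have "orbit_related U V" using orbit_related_sym[OF V U(2)] rep[OF V] unfolding U_def by auto
    then obtain g r where g: "g \<in> carrier G" "close_sets dist r (g <# U) V" unfolding orbit_related_def by auto
    obtain V' where V': "V' \<in> \<U>" "close_sets dist M (g <# U) V'" using permuted[OF g(1) U(2)] by auto
    have gU: "g <# U \<subseteq> carrier G" using c[OF g(1) subsets[OF U(2)]] .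
    have "close_sets dist (M + r) V' V"
      using g V' gU subsets[OF V] subsets[OF V'(1)] by (intro close_trans[of _ "g <# U"] close_sym[of "g <# U" V']) auto
    then have "close_sets dist M V' V" using bounded V V'(1) by blast
    then have "close_sets dist (M + M) (g <# U) V"
      using V' gU subsets[OF V] subsets[OF V'(1)] by (intro close_trans[of _ V']) auto
    then have "close_sets dist (D + (M + M)) (g <# coarse_stabiliser U) V"
      by (rule close_trans[OF c[OF g(1) sub] gU subsets[OF V] gD[OF U(1) g(1)]])
    then show ?thesis using coset U g by blast
  qed
  have 3: "W = W'" if W: "W \<in> all_lcosets G \<P>" "W' \<in> all_lcosets G \<P>" "close_sets dist r W W'" for W W' r
  proof -
    obtain U g where U: "U \<in> R" "g \<in> carrier G" "W = g <# coarse_stabiliser U" using W coset by auto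
    obtain U' g' where U': "U' \<in> R" "g' \<in> carrier G" "W' = g' <# coarse_stabiliser U'" using W coset by auto
    have UU: "U \<in> \<U>" "U' \<in> \<U>" using U U' RU by auto
    note s = subsets[OF UU(1)] subsets[OF UU(2)]
    have "close_sets dist D (g <# U) W" using close_sym[OF _ _ gD[OF U(1,2)]] U c[OF U(2)] s sub by auto
    then have "close_sets dist (D + r) (g <# U) W'"
      using W U U' c s sub by (intro close_trans[of _ W]) auto
    then have gg: "close_sets dist (D + r + D) (g <# U) (g' <# U')"
      using gD[OF U'(1,2)] U U' c s sub by (intro close_trans[of _ W' _ "D + r" D]) auto
    have "close_sets dist (D + r + D) (inv g' <# (g <# U)) (inv g' <# (g' <# U'))"
      using gg U U' c s by (intro close_left) auto
    then have gg': "close_sets dist (D + r + D) ((inv g' \<otimes> g) <# U) U'"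
      using U U' s by (simp add: lcos_m_assoc lcos_mult_one)
    then have "orbit_related U U'" unfolding orbit_related_def using U U' by auto
    then have eq: "U = U'" using rep_eq[OF UU] rep_rep U U' by auto
    then have "inv g' \<otimes> g \<in> coarse_stabiliser U" using gg' U U' unfolding coarse_stabiliser_def by auto
    moreover have "g = g' \<otimes> (inv g' \<otimes> g)" using U U' by (simp add: m_assoc[symmetric])
    ultimately have "g \<in> g' <# coarse_stabiliser U" unfolding l_coset_def by blast
    then show ?thesis
      using l_repr_independence[OF _ U'(2) subgroup_coarse_stabiliser[OF s(1)], of g] U U' eq by auto
  qed
  have "finite \<P>" "\<forall>P\<in>\<P>. subgroup P G" unfolding \<P>_def using finR subgroup_coarse_stabiliser subsets RU by auto
  then show ?thesis
    using 1 2 3 by (intro exI[of _ \<P>] exI[of _ "D + (M + M)"] conjI ballI allI impI) auto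
qed

end

section \<open>Coning off families of subsets\<close>

text \<open>Coning off an arbitrary family of subsets has the advantage that the deletion of a cone
  vertex gives a graph of the same form.\<close>

definition cone_graph :: "('a, 'm) monoid_scheme \<Rightarrow> 'a set \<Rightarrow> 'a set set \<Rightarrow> ('a + 'a set) ugraph" where
  "cone_graph G S \<C> =
     \<lparr>verts = Inl ` carrier G \<union> Inr ` \<C>,
      edges = {{Inl g, Inl (g \<otimes>\<^bsub>G\<^esub> s)} | g s. g \<in> carrier G \<and> s \<in> S}
            \<union> {{Inl x, Inr U} | x U. U \<in> \<C> \<and> x \<in> U}\<rparr>"

lemma coned_off_cayley_graph_eq: "coned_off_cayley_graph G \<P> S = cone_graph G S (all_lcosets G \<P>)"
  unfolding coned_off_cayley_graph_def cone_graph_def ..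

lemma delete_cone_vertex: "delete_vertex (cone_graph G S \<C>) (Inr V) = cone_graph G S (\<C> - {V})"
proof -
  have "Inl ` carrier G \<union> Inr ` \<C> - {Inr V} = Inl ` carrier G \<union> Inr ` (\<C> - {V})" by auto
  moreover have "{e \<in> {{Inl g, Inl (g \<otimes>\<^bsub>G\<^esub> s)} | g s. g \<in> carrier G \<and> s \<in> S}
            \<union> {{Inl x, Inr U} | x U. U \<in> \<C> \<and> x \<in> U}. Inr V \<notin> e} =
       {{Inl g, Inl (g \<otimes>\<^bsub>G\<^esub> s)} | g s. g \<in> carrier G \<and> s \<in> S}
            \<union> {{Inl x, Inr U} | x U. U \<in> \<C> - {V} \<and> x \<in> U}" by blast
  ultimately show ?thesis unfolding delete_vertex_def cone_graph_def by simp
qed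

lemma verts_cone_graph: "verts (cone_graph G S \<C>) = Inl ` carrier G \<union> Inr ` \<C>"
  by (simp add: cone_graph_def)

lemma cone_graph_edge_cases:
  assumes "{u, v} \<in> edges (cone_graph G S \<C>)"
  obtains g s where "g \<in> carrier G" "s \<in> S" "u = Inl g \<and> v = Inl (g \<otimes>\<^bsub>G\<^esub> s) \<or> v = Inl g \<and> u = Inl (g \<otimes>\<^bsub>G\<^esub> s)"
  | x U where "U \<in> \<C>" "x \<in> U" "u = Inl x \<and> v = Inr U \<or> v = Inl x \<and> u = Inr U"
proof -
  have "(\<exists>g s. g \<in> carrier G \<and> s \<in> S \<and> {u, v} = {Inl g, Inl (g \<otimes>\<^bsub>G\<^esub> s)}) \<or>
    (\<exists>x U. U \<in> \<C> \<and> x \<in> U \<and> {u, v} = {Inl x, Inr U})"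
    using assms unfolding cone_graph_def by auto
  then show ?thesis using that unfolding doubleton_eq_iff by metis
qed

lemma neighbours_cone:
  assumes "V \<in> \<C>" "V \<subseteq> carrier G"
  shows "neighbours (cone_graph G S \<C>) (Inr V) = Inl ` V"
proof -
  have "{Inl x, Inr V} \<in> edges (cone_graph G S \<C>)" if "x \<in> V" for x
    using that assms unfolding cone_graph_def by auto
  then have "Inl ` V \<subseteq> neighbours (cone_graph G S \<C>) (Inr V)"
    using assms unfolding neighbours_def verts_cone_graph by auto
  moreover have "u \<in> Inl ` V" if "{u, Inr V} \<in> edges (cone_graph G S \<C>)" for u
    using that by (rule cone_graph_edge_cases) auto
  ultimately show ?thesis unfolding neighbours_def by blast
qed

context word_metric
begin

lemma cone_graph_dist_elements:
  assumes "g \<in> carrier G" "h \<in> carrier G" "dist g h \<le> real n"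
  shows "graph_dist (cone_graph G S \<C>) (Inl g) (Inl h) \<le> enat n"
  using assms by (intro graph_dist_le_dist) (auto simp: cone_graph_def)

lemma cone_graph_dist_cone:
  assumes "g \<in> carrier G" "U \<in> \<C>" "x \<in> U" "x \<in> carrier G" "dist g x \<le> real n"
  shows "graph_dist (cone_graph G S \<C>) (Inl g) (Inr U) \<le> enat (n + 1)"
proof (rule graph_dist_le_trans)
  show "graph_dist (cone_graph G S \<C>) (Inl g) (Inl x) \<le> enat n"
    using assms by (intro cone_graph_dist_elements)
  show "graph_dist (cone_graph G S \<C>) (Inl x) (Inr U) \<le> enat 1"
    using assms by (intro graph_dist_edge) (auto simp: cone_graph_def)
qed

lemma connected_cone_graph:
  assumes "\<And>U. U \<in> \<C> \<Longrightarrow> U \<subseteq> carrier G \<and> U \<noteq> {}"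
  shows "connected_graph (cone_graph G S \<C>)"
proof -
  let ?\<Gamma> = "cone_graph G S \<C>"
  have one: "\<exists>n. graph_dist ?\<Gamma> (Inl \<one>) u \<le> enat n" if u: "u \<in> verts ?\<Gamma>" for u
  proof -
    consider g where "g \<in> carrier G" "u = Inl g" | U where "U \<in> \<C>" "u = Inr U"
      using u unfolding verts_cone_graph by auto
    then show ?thesis
    proof cases
      case 1
      then show ?thesis using cone_graph_dist_elements[of \<one> g "norm (inv \<one> \<otimes> g)"] dist_norm[of \<one> g] by auto
    next
      case 2
      then obtain x where "x \<in> U" "x \<in> carrier G" using assms by blast
      then show ?thesis using cone_graph_dist_cone[of \<one> U \<C> x "norm (inv \<one> \<otimes> x)"] dist_norm[of \<one> x] 2 by auto
    qed
  qed
  show ?thesis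
    unfolding connected_graph_def
  proof (intro ballI)
    fix u v assume "u \<in> verts ?\<Gamma>" "v \<in> verts ?\<Gamma>"
    then obtain m n where "graph_dist ?\<Gamma> u (Inl \<one>) \<le> enat m" "graph_dist ?\<Gamma> (Inl \<one>) v \<le> enat n"
      using one graph_dist_sym by metis
    then have "graph_dist ?\<Gamma> u v \<le> enat (m + n)" by (rule graph_dist_le_trans)
    then show "\<exists>p. walk ?\<Gamma> u p v" unfolding graph_dist_le_iff by blast
  qed
qed

text \<open>If \<open>V\<close> stays close to \<open>V'\<close>, then any two of its points are joined by a path of bounded length
  through the cone vertex of \<open>V'\<close>, which avoids that of \<open>V\<close>.\<close>

lemma fine_cone_separated:
  assumes fine: "fine_at (cone_graph G S \<C>) (Inr V)"
    and V: "V \<in> \<C>" "V' \<in> \<C>" "V \<noteq> V'" "V \<subseteq> carrier G" "V' \<subseteq> carrier G"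
    and near: "\<And>v. v \<in> V \<Longrightarrow> \<exists>v'\<in>V'. dist v v' \<le> r"
  shows "finite V"
proof (cases "V = {}")
  case False
  then obtain v0 where v0: "v0 \<in> V" by blast
  let ?\<Gamma> = "cone_graph G S (\<C> - {V})"
  define n where "n = nat \<lceil>r\<rceil>"
  have to_V': "graph_dist ?\<Gamma> (Inl v) (Inr V') \<le> enat (n + 1)" if v: "v \<in> V" for v
  proof -
    obtain v' where v': "v' \<in> V'" "dist v v' \<le> r" using near[OF v] by blast
    have "dist v v' \<le> real n" using v'(2) unfolding n_def by linarith
    then show ?thesis using v v' V by (intro cone_graph_dist_cone[of v V' _ v']) auto
  qed
  have "graph_dist ?\<Gamma> (Inl v0) (Inl v) \<le> enat ((n + 1) + (n + 1))" if "v \<in> V" for v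
    using graph_dist_le_trans[OF to_V'[OF v0] to_V'[OF that, unfolded graph_dist_sym[of _ "Inl v"]]] .
  then have "Inl ` V \<subseteq> {y \<in> neighbours (cone_graph G S \<C>) (Inr V). angle (cone_graph G S \<C>) (Inr V) (Inl v0) y \<le> enat ((n + 1) + (n + 1))}"
    unfolding angle_def delete_cone_vertex neighbours_cone[OF V(1,4)] by auto
  moreover have "finite {y \<in> neighbours (cone_graph G S \<C>) (Inr V). angle (cone_graph G S \<C>) (Inr V) (Inl v0) y \<le> enat ((n + 1) + (n + 1))}"
    using fine v0 neighbours_cone[OF V(1,4)] unfolding fine_at_def by blast
  ultimately have "finite (Inl ` V :: ('a + 'a set) set)" by (rule finite_subset)
  then show ?thesis by (simp add: finite_image_iff)
qed simp

end

text \<open>The conditions under which \<open>f\<close> and \<open>\<phi>\<close> together are Lipschitz on cone graphs. Paths realising the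
  bound stay in the Cayley graph except at the images of cone vertices, so they remain available
  when other cone vertices are deleted.\<close>

locale cone_map = G: word_metric G S + H: word_metric H T
  for G :: "('a, 'm) monoid_scheme" and S and H :: "('b, 'n) monoid_scheme" and T +
  fixes \<C> :: "'a set set" and \<D> :: "'b set set"
    and f :: "'a \<Rightarrow> 'b" and \<phi> :: "'a set \<Rightarrow> 'b set" and N :: nat
  assumes f_closed: "g \<in> carrier G \<Longrightarrow> f g \<in> carrier H"
    and \<phi>_closed: "U \<in> \<C> \<Longrightarrow> \<phi> U \<in> \<D>"
    and \<C>_subset: "U \<in> \<C> \<Longrightarrow> U \<subseteq> carrier G" and \<D>_subset: "V \<in> \<D> \<Longrightarrow> V \<subseteq> carrier H"
    and f_edge: "\<lbrakk>g \<in> carrier G; s \<in> S\<rbrakk> \<Longrightarrow> word_dist H T (f g) (f (g \<otimes>\<^bsub>G\<^esub> s)) \<le> N"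
    and f_coset: "\<lbrakk>U \<in> \<C>; x \<in> U\<rbrakk> \<Longrightarrow> \<exists>v\<in>\<phi> U. word_dist H T (f x) v \<le> N"
begin

lemma verts_map: "u \<in> verts (cone_graph G S \<C>) \<Longrightarrow> map_sum f \<phi> u \<in> verts (cone_graph H T \<D>)"
  using f_closed \<phi>_closed unfolding verts_cone_graph by auto

lemma edge_map:
  assumes "{u, v} \<in> edges (cone_graph G S \<C>)"
  shows "graph_dist (cone_graph H T \<D>) (map_sum f \<phi> u) (map_sum f \<phi> v) \<le> enat (N + 1)"
  using assms
proof (cases rule: cone_graph_edge_cases)
  case (1 g s)
  have "g \<otimes>\<^bsub>G\<^esub> s \<in> carrier G" using 1 G.S_subset by auto
  then have "graph_dist (cone_graph H T \<D>) (Inl (f g)) (Inl (f (g \<otimes>\<^bsub>G\<^esub> s))) \<le> enat N"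
    using 1 f_closed f_edge by (intro H.cone_graph_dist_elements) auto
  then have "graph_dist (cone_graph H T \<D>) (Inl (f g)) (Inl (f (g \<otimes>\<^bsub>G\<^esub> s))) \<le> enat (N + 1)"
    by (rule order_trans) simp
  then show ?thesis using 1 by (auto simp: graph_dist_sym)
next
  case (2 x U)
  obtain v where v: "v \<in> \<phi> U" "word_dist H T (f x) v \<le> N" using f_coset 2 by blast
  have "x \<in> carrier G" "v \<in> carrier H" using 2 v \<C>_subset \<D>_subset \<phi>_closed by blast+
  then have "graph_dist (cone_graph H T \<D>) (Inl (f x)) (Inr (\<phi> U)) \<le> enat (N + 1)"
    using v 2 f_closed \<phi>_closed by (intro H.cone_graph_dist_cone) auto
  then show ?thesis using 2 by (auto simp: graph_dist_sym)
qed

lemma delete: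
  assumes "U \<in> \<C>" "inj_on \<phi> \<C>"
  shows "cone_map G S H T (\<C> - {U}) (\<D> - {\<phi> U}) f \<phi> N"
proof -
  have "\<phi> U' \<in> \<D> - {\<phi> U}" if "U' \<in> \<C> - {U}" for U'
    using that assms \<phi>_closed unfolding inj_on_def by blast
  then show ?thesis
    using f_closed \<C>_subset \<D>_subset f_edge f_coset by unfold_locales auto
qed

text \<open>A short path from \<open>x\<close> to \<open>y\<close> that avoids the cone vertex of \<open>U\<close> maps to a short path that avoids
  the cone vertex of \<open>\<phi> U\<close>, by injectivity of \<open>\<phi>\<close>. So \<open>c y\<close> is in a finite set, and \<open>c\<close> has finite
  fibres.\<close>

lemma fine_at_pullback:
  assumes U: "U \<in> \<C>" and inj: "inj_on \<phi> \<C>"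
    and fine: "fine_at (cone_graph H T \<D>) (Inr (\<phi> U))"
    and c: "\<And>x. x \<in> U \<Longrightarrow> c x \<in> \<phi> U \<and> word_dist H T (f x) (c x) \<le> N"
    and fib: "\<And>v. finite {x \<in> U. c x = v}"
  shows "fine_at (cone_graph G S \<C>) (Inr U)"
  unfolding fine_at_def
proof (intro ballI allI)
  interpret del: cone_map G S H T "\<C> - {U}" "\<D> - {\<phi> U}" f \<phi> N
    using delete[OF U inj] .
  let ?\<Gamma> = "cone_graph G S (\<C> - {U})" and ?\<Gamma>' = "cone_graph H T (\<D> - {\<phi> U})"
  have UC: "U \<subseteq> carrier G" "\<phi> U \<in> \<D>" "\<phi> U \<subseteq> carrier H"
    using \<C>_subset[OF U] \<phi>_closed[OF U] \<D>_subset by auto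
  fix x r assume "x \<in> neighbours (cone_graph G S \<C>) (Inr U)"
  then obtain x0 where x0: "x = Inl x0" "x0 \<in> U" using neighbours_cone[OF U UC(1)] by auto
  define R where "R = N + ((N + 1) * r + N)"
  define F where "F = {v \<in> \<phi> U. angle (cone_graph H T \<D>) (Inr (\<phi> U)) (Inl (c x0)) (Inl v) \<le> enat R}"
  have "finite {y \<in> neighbours (cone_graph H T \<D>) (Inr (\<phi> U)). angle (cone_graph H T \<D>) (Inr (\<phi> U)) (Inl (c x0)) y \<le> enat R}"
    using fine c[OF x0(2)] neighbours_cone[OF UC(2,3)] unfolding fine_at_def by blast
  moreover have "Inl ` F \<subseteq> {y \<in> neighbours (cone_graph H T \<D>) (Inr (\<phi> U)). angle (cone_graph H T \<D>) (Inr (\<phi> U)) (Inl (c x0)) y \<le> enat R}"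
    unfolding F_def neighbours_cone[OF UC(2,3)] by auto
  ultimately have "finite (Inl ` F :: ('b + 'b set) set)" by (rule finite_subset[rotated])
  then have finF: "finite F" by (simp add: finite_image_iff)
  have near: "graph_dist ?\<Gamma>' (Inl (f y)) (Inl (c y)) \<le> enat N" if "y \<in> U" for y
    using that c[OF that] UC f_closed by (intro H.cone_graph_dist_elements) auto
  have "y \<in> Inl ` (\<Union>v\<in>F. {x \<in> U. c x = v})"
    if y: "y \<in> neighbours (cone_graph G S \<C>) (Inr U)" "angle (cone_graph G S \<C>) (Inr U) x y \<le> enat r" for y
  proof -
    obtain y0 where y0: "y = Inl y0" "y0 \<in> U" using y neighbours_cone[OF U UC(1)] by auto
    have "graph_dist ?\<Gamma> (Inl x0) (Inl y0) \<le> enat r"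
      using y(2) unfolding angle_def delete_cone_vertex x0 y0 .
    then have "graph_dist ?\<Gamma>' (map_sum f \<phi> (Inl x0)) (map_sum f \<phi> (Inl y0)) \<le> enat ((N + 1) * r)"
      by (intro graph_dist_map[OF del.edge_map del.verts_map])
    then have "graph_dist ?\<Gamma>' (Inl (c x0)) (Inl (c y0)) \<le> enat R"
      unfolding R_def map_sum.simps using near[OF x0(2)] near[OF y0(2)]
      by (metis graph_dist_le_trans graph_dist_sym)
    then have "c y0 \<in> F" unfolding F_def angle_def delete_cone_vertex using c[OF y0(2)] by simp
    then show ?thesis using y0 by auto
  qed
  then have "{y \<in> neighbours (cone_graph G S \<C>) (Inr U). angle (cone_graph G S \<C>) (Inr U) x y \<le> enat r}
      \<subseteq> Inl ` (\<Union>v\<in>F. {x \<in> U. c x = v})" by blast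
  then show "finite {y \<in> neighbours (cone_graph G S \<C>) (Inr U). angle (cone_graph G S \<C>) (Inr U) x y \<le> enat r}"
    by (rule finite_subset) (use finF fib in blast)
qed

end

text \<open>The two maps are quasi-inverse on elements by hypothesis. On cone vertices they are as well,
  since \<open>U\<close> and \<open>\<chi> (\<phi> U)\<close> contain points that are close to each other.\<close>

lemma hyperbolic_cone_graph_pullback:
  assumes "cone_map G S H T \<C> \<D> f \<phi> N" "cone_map H T G S \<D> \<C> b \<chi> N"
    and ne: "\<And>U. U \<in> \<C> \<Longrightarrow> U \<noteq> {}" "\<And>V. V \<in> \<D> \<Longrightarrow> V \<noteq> {}"
    and bf: "\<And>g. g \<in> carrier G \<Longrightarrow> word_dist G S (b (f g)) g \<le> N"
    and \<chi>\<phi>: "\<And>U. U \<in> \<C> \<Longrightarrow> \<exists>x\<in>\<chi> (\<phi> U). \<exists>y\<in>U. word_dist G S x y \<le> N"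
    and hyp: "hyperbolic_graph (cone_graph H T \<D>)"
  shows "hyperbolic_graph (cone_graph G S \<C>)"
proof -
  interpret F: cone_map G S H T \<C> \<D> f \<phi> N by fact
  interpret B: cone_map H T G S \<D> \<C> b \<chi> N by fact
  let ?\<Gamma> = "cone_graph G S \<C>" and ?\<Gamma>' = "cone_graph H T \<D>"
  have con: "connected_graph ?\<Gamma>" "connected_graph ?\<Gamma>'"
    using F.G.connected_cone_graph[of \<C>] F.H.connected_cone_graph[of \<D>] ne F.\<C>_subset F.\<D>_subset
    by blast+
  show ?thesis
  proof (rule hyperbolic_graph_pullback[OF con hyp, of "map_sum f \<phi>" "N + 2" "map_sum b \<chi>"])
    show "map_sum f \<phi> x \<in> verts ?\<Gamma>'" if "x \<in> verts ?\<Gamma>" for x using F.verts_map[OF that] .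
    show "map_sum b \<chi> x \<in> verts ?\<Gamma>" if "x \<in> verts ?\<Gamma>'" for x using B.verts_map[OF that] .
    show "graph_dist ?\<Gamma>' (map_sum f \<phi> x) (map_sum f \<phi> y) \<le> enat (N + 2)" if "{x, y} \<in> edges ?\<Gamma>" for x y
      using F.edge_map[OF that] by (rule order_trans) simp
    show "graph_dist ?\<Gamma> (map_sum b \<chi> x) (map_sum b \<chi> y) \<le> enat (N + 2)" if "{x, y} \<in> edges ?\<Gamma>'" for x y
      using B.edge_map[OF that] by (rule order_trans) simp
    fix u assume "u \<in> verts ?\<Gamma>"
    then consider g where "g \<in> carrier G" "u = Inl g" | U where "U \<in> \<C>" "u = Inr U"
      unfolding verts_cone_graph by auto
    then show "graph_dist ?\<Gamma> (map_sum b \<chi> (map_sum f \<phi> u)) u \<le> enat (N + 2)"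
    proof cases
      case 1
      then have "graph_dist ?\<Gamma> (Inl (b (f g))) (Inl g) \<le> enat N"
        using bf F.f_closed B.f_closed by (intro F.G.cone_graph_dist_elements) auto
      then have "graph_dist ?\<Gamma> (Inl (b (f g))) (Inl g) \<le> enat (N + 2)" by (rule order_trans) simp
      then show ?thesis using 1 by simp
    next
      case 2
      obtain x y where xy: "x \<in> \<chi> (\<phi> U)" "y \<in> U" "word_dist G S x y \<le> N" using \<chi>\<phi> 2 by blast
      have C: "\<chi> (\<phi> U) \<in> \<C>" using 2 F.\<phi>_closed B.\<phi>_closed by blast
      have xyc: "x \<in> carrier G" "y \<in> carrier G" using xy C 2 F.\<C>_subset by blast+
      have "graph_dist ?\<Gamma> (Inl x) (Inr (\<chi> (\<phi> U))) \<le> enat (0 + 1)"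
        using xy xyc C by (intro F.G.cone_graph_dist_cone[of x _ _ x]) auto
      then have "graph_dist ?\<Gamma> (Inr (\<chi> (\<phi> U))) (Inl x) \<le> enat (0 + 1)"
        by (subst graph_dist_sym)
      moreover have "graph_dist ?\<Gamma> (Inl x) (Inr U) \<le> enat (N + 1)"
        using xy xyc 2 by (intro F.G.cone_graph_dist_cone[of x _ _ y]) auto
      ultimately have "graph_dist ?\<Gamma> (Inr (\<chi> (\<phi> U))) (Inr U) \<le> enat ((0 + 1) + (N + 1))"
        by (rule graph_dist_le_trans)
      then show ?thesis using 2 by simp
    qed
  qed
qed

section \<open>Pulling back cosets along a quasi-isometry\<close>

locale group_quasi_isometry = G: word_metric G A + H: word_metric H B
  for G :: "('a, 'm) monoid_scheme" and A and H :: "('b, 'n) monoid_scheme" and B +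
  fixes q :: "'a \<Rightarrow> 'b" and L C :: real
  assumes qi: "quasi_isometry_with L C (carrier G) (word_dist G A) (carrier H) (word_dist H B) q"
begin

abbreviation "dG \<equiv> word_dist G A"
abbreviation "dH \<equiv> word_dist H B"

lemma L_ge: "L \<ge> 1" and C_ge: "C \<ge> 0" and q_closed: "x \<in> carrier G \<Longrightarrow> q x \<in> carrier H"
  using qi unfolding quasi_isometry_with_def by auto

lemma upper: "\<lbrakk>x \<in> carrier G; y \<in> carrier G\<rbrakk> \<Longrightarrow> dH (q x) (q y) \<le> L * dG x y + C"
  using qi unfolding quasi_isometry_with_def by auto

lemma lower: 
  assumes "x \<in> carrier G" "y \<in> carrier G"
  shows "dG x y \<le> L * (dH (q x) (q y) + C)"
proof -
  have "dG x y / L - C \<le> dH (q x) (q y)"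
    using qi assms unfolding quasi_isometry_with_def by auto
  then have "dG x y / L \<le> dH (q x) (q y) + C" by simp
  then show ?thesis using L_ge by (simp add: field_simps)
qed

lemma upper_mono: "\<lbrakk>x \<in> carrier G; y \<in> carrier G; dG x y \<le> r\<rbrakk> \<Longrightarrow> dH (q x) (q y) \<le> L * r + C"
  using upper[of x y] mult_left_mono[of "dG x y" r L] L_ge by linarith

lemma lower_mono: "\<lbrakk>x \<in> carrier G; y \<in> carrier G; dH (q x) (q y) \<le> r\<rbrakk> \<Longrightarrow> dG x y \<le> L * (r + C)"
  using lower[of x y] mult_left_mono[of "dH (q x) (q y) + C" "r + C" L] L_ge by linarith

definition q_inv :: "'b \<Rightarrow> 'a" where
  "q_inv h = (SOME x. x \<in> carrier G \<and> dH (q x) h \<le> C)"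

lemma q_inv:
  assumes "h \<in> carrier H"
  shows q_inv_closed: "q_inv h \<in> carrier G" and q_q_inv: "dH (q (q_inv h)) h \<le> C"
proof -
  have "\<exists>x. x \<in> carrier G \<and> dH (q x) h \<le> C"
    using qi assms unfolding quasi_isometry_with_def by auto
  then have "q_inv h \<in> carrier G \<and> dH (q (q_inv h)) h \<le> C" unfolding q_inv_def by (rule someI_ex)
  then show "q_inv h \<in> carrier G" "dH (q (q_inv h)) h \<le> C" by auto
qed

lemma q_q_inv_close:
  assumes "h \<in> carrier H" "x \<in> carrier H" "dH x h \<le> r"
  shows "dH x (q (q_inv h)) \<le> r + C"
  using H.dist_triangle[of x h "q (q_inv h)"] H.dist_sym[of h "q (q_inv h)"] q_inv assms q_closed by fastforce

lemma dist_q_q_inv: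
  assumes "g \<in> carrier H" "h \<in> carrier H"
  shows "dH (q (q_inv g)) (q (q_inv h)) \<le> dH g h + 2 * C" "dH g h \<le> dH (q (q_inv g)) (q (q_inv h)) + 2 * C"
proof -
  note c = q_inv[OF assms(1)] q_inv[OF assms(2)]
  have "dH (q (q_inv g)) (q (q_inv h)) \<le> dH (q (q_inv g)) g + dH g (q (q_inv h))" "dH g (q (q_inv h)) \<le> dH g h + dH h (q (q_inv h))"
    "dH g h \<le> dH g (q (q_inv g)) + dH (q (q_inv g)) h" "dH (q (q_inv g)) h \<le> dH (q (q_inv g)) (q (q_inv h)) + dH (q (q_inv h)) h"
    using c q_closed assms by (auto intro!: H.dist_triangle)
  moreover have "dH h (q (q_inv h)) = dH (q (q_inv h)) h" "dH g (q (q_inv g)) = dH (q (q_inv g)) g"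
    using c q_closed assms by (auto intro!: H.dist_sym)
  ultimately show "dH (q (q_inv g)) (q (q_inv h)) \<le> dH g h + 2 * C" "dH g h \<le> dH (q (q_inv g)) (q (q_inv h)) + 2 * C"
    using c by linarith+
qed

lemma dist_q_inv: 
  assumes "g \<in> carrier H" "h \<in> carrier H"
  shows "dG (q_inv g) (q_inv h) \<le> L * (dH g h + 3 * C)" "dH g h \<le> L * dG (q_inv g) (q_inv h) + 3 * C"
proof -
  note c = q_inv[OF assms(1)] q_inv[OF assms(2)]
  show "dG (q_inv g) (q_inv h) \<le> L * (dH g h + 3 * C)"
    using lower_mono[OF c(1,3) dist_q_q_inv(1)[OF assms]] by (simp add: algebra_simps)
  show "dH g h \<le> L * dG (q_inv g) (q_inv h) + 3 * C"
    using dist_q_q_inv(2)[OF assms] upper[OF c(1,3)] by linarith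
qed

lemma finite_preimage_ball:
  assumes "finite A" "h \<in> carrier H"
  shows "finite {x \<in> carrier G. dH (q x) h \<le> r}"
proof (cases "{x \<in> carrier G. dH (q x) h \<le> r} = {}")
  case False
  then obtain x0 where x0: "x0 \<in> carrier G" "dH (q x0) h \<le> r" by auto
  have "dG x0 x \<le> L * ((r + r) + C)" if x: "x \<in> carrier G" "dH (q x) h \<le> r" for x
  proof (rule lower_mono[OF x0(1) x(1)])
    show "dH (q x0) (q x) \<le> r + r"
      using H.dist_triangle[of "q x0" h "q x"] H.dist_sym[of h "q x"] x0 x assms q_closed by auto
  qed
  then have "{x \<in> carrier G. dH (q x) h \<le> r} \<subseteq> {x \<in> carrier G. dG x0 x \<le> L * ((r + r) + C)}" by auto
  then show ?thesis using G.finite_ball[OF assms(1) x0(1)] finite_subset by blast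
next
  case True
  then show ?thesis by (simp only: finite.emptyI)
qed

lemma close_image_q:
  assumes "W \<subseteq> carrier G" "V \<subseteq> carrier H" "close_sets dG r W (q_inv ` V)"
  shows "close_sets dH (L * r + C + C) (q ` W) V"
proof -
  have "dH (q w) v \<le> L * r + C + C" if "w \<in> W" "v \<in> V" "dG w (q_inv v) \<le> r" for w v
  proof -
    have c: "w \<in> carrier G" "v \<in> carrier H" using that assms by auto
    have "dH (q w) (q (q_inv v)) \<le> L * r + C" using upper_mono c q_inv that by auto
    then show ?thesis using H.dist_triangle[of "q w" "q (q_inv v)" v] q_closed c q_inv[OF c(2)] by auto
  qed
  then show ?thesis using assms(3) unfolding close_sets_def by fastforce
qed

lemma close_of_close_images:
  assumes "W \<subseteq> carrier G" "W' \<subseteq> carrier G" "close_sets dH r (q ` W) (q ` W')"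
  shows "close_sets dG (L * (r + C)) W W'"
proof -
  have l: "dG x y \<le> L * (r + C)" if "x \<in> W" "y \<in> W'" "dH (q x) (q y) \<le> r" for x y
    using that assms by (intro lower_mono) auto
  show ?thesis
    unfolding close_sets_def
  proof (intro conjI ballI)
    fix x assume x: "x \<in> W"
    then obtain y where "y \<in> W'" "dH (q x) (q y) \<le> r" using assms(3) unfolding close_sets_def by blast
    then show "\<exists>y\<in>W'. dG x y \<le> L * (r + C)" using l x by blast
  next
    fix y assume y: "y \<in> W'"
    then obtain x where "x \<in> W" "dH (q x) (q y) \<le> r" using assms(3) unfolding close_sets_def by blast
    then show "\<exists>x\<in>W. dG x y \<le> L * (r + C)" using l y by blast
  qed
qed

lemma close_of_close_q_inv:
  assumes "V \<subseteq> carrier H" "V' \<subseteq> carrier H" "close_sets dG r (q_inv ` V) (q_inv ` V')"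
  shows "close_sets dH (L * r + 3 * C) V V'"
proof -
  have l: "dH x y \<le> L * r + 3 * C" if "x \<in> V" "y \<in> V'" "dG (q_inv x) (q_inv y) \<le> r" for x y
  proof -
    have "L * dG (q_inv x) (q_inv y) \<le> L * r" using that(3) L_ge by (intro mult_left_mono) auto
    moreover have "dH x y \<le> L * dG (q_inv x) (q_inv y) + 3 * C" using that assms by (intro dist_q_inv(2)) auto
    ultimately show ?thesis by linarith
  qed
  show ?thesis
    unfolding close_sets_def
  proof (intro conjI ballI)
    fix x assume x: "x \<in> V"
    then obtain y where "y \<in> V'" "dG (q_inv x) (q_inv y) \<le> r" using assms(3) unfolding close_sets_def by blast
    then show "\<exists>y\<in>V'. dH x y \<le> L * r + 3 * C" using l x by blast
  next
    fix y assume y: "y \<in> V'"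
    then obtain x where "x \<in> V" "dG (q_inv x) (q_inv y) \<le> r" using assms(3) unfolding close_sets_def by blast
    then show "\<exists>x\<in>V. dH x y \<le> L * r + 3 * C" using l y by blast
  qed
qed

text \<open>The quasi-isometries to which the hypothesis that the collection is qi-characteristic will be
  applied. Their constants are independent of \<open>g\<close> because left translations are isometries.\<close>

lemma conjugated_translation_qi:
  assumes g: "g \<in> carrier G"
  shows "quasi_isometry_with (L * L) (3 * L * L * C + 2 * C) (carrier H) dH (carrier H) dH (\<lambda>h. q (g \<otimes>\<^bsub>G\<^esub> q_inv h))"
  unfolding quasi_isometry_with_def
proof (intro conjI ballI)
  have LL: "L * L \<ge> 1" using L_ge mult_mono[of 1 L 1 L] by simp
  then show "1 \<le> L * L" .
  have LC: "0 \<le> L * L * C" using L_ge C_ge by simp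
  then show "0 \<le> 3 * L * L * C + 2 * C" using C_ge by simp
  show "(\<lambda>h. q (g \<otimes>\<^bsub>G\<^esub> q_inv h)) \<in> carrier H \<rightarrow> carrier H" using g q_inv q_closed by auto
  fix h h' assume h: "h \<in> carrier H" "h' \<in> carrier H"
  have eq: "dG (g \<otimes>\<^bsub>G\<^esub> q_inv h) (g \<otimes>\<^bsub>G\<^esub> q_inv h') = dG (q_inv h) (q_inv h')"
    using g h q_inv by (intro G.dist_left) auto
  have c: "g \<otimes>\<^bsub>G\<^esub> q_inv h \<in> carrier G" "g \<otimes>\<^bsub>G\<^esub> q_inv h' \<in> carrier G" using g h q_inv by auto
  let ?d = "dH (q (g \<otimes>\<^bsub>G\<^esub> q_inv h)) (q (g \<otimes>\<^bsub>G\<^esub> q_inv h'))"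
  have "?d \<le> L * (L * (dH h h' + 3 * C)) + C"
    using upper_mono[OF c, of "L * (dH h h' + 3 * C)"] eq dist_q_inv(1)[OF h] by simp
  then show "?d \<le> L * L * dH h h' + (3 * L * L * C + 2 * C)"
    using C_ge by (simp add: algebra_simps)
  have "dG (q_inv h) (q_inv h') \<le> L * (?d + C)" using lower[OF c] eq by simp
  then have "L * dG (q_inv h) (q_inv h') \<le> L * (L * (?d + C))" using L_ge by (intro mult_left_mono) auto
  then have "dH h h' \<le> L * (L * (?d + C)) + 3 * C" using dist_q_inv(2)[OF h] by linarith
  also have "\<dots> \<le> L * L * (?d + (3 * L * L * C + 2 * C))"
  proof -
    have CL: "C \<le> L * L * C" using mult_right_mono[OF LL C_ge] by simp
    then have "4 * C \<le> 3 * L * L * C + 2 * C" using C_ge by simp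
    then have "L * L * (4 * C) \<le> L * L * (3 * L * L * C + 2 * C)"
      using LL by (intro mult_left_mono) auto
    then show ?thesis using CL by (simp add: algebra_simps)
  qed
  finally show "dH h h' / (L * L) - (3 * L * L * C + 2 * C) \<le> ?d"
    using LL by (simp add: field_simps)
next
  fix h assume h: "h \<in> carrier H"
  \<comment> \<open>The element \<open>q w\<close> is almost mapped to \<open>h\<close>, since \<open>q_inv (q w)\<close> is close to \<open>w\<close>.\<close>
  define w where "w = inv\<^bsub>G\<^esub> g \<otimes>\<^bsub>G\<^esub> q_inv h"
  have w: "w \<in> carrier G" "g \<otimes>\<^bsub>G\<^esub> w = q_inv h"
    using g q_inv[OF h] unfolding w_def by (auto simp: G.m_assoc[symmetric])
  have qw: "q w \<in> carrier H" using w q_closed by auto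
  have c: "g \<otimes>\<^bsub>G\<^esub> q_inv (q w) \<in> carrier G" using q_inv[OF qw] g by simp
  have "dG (q_inv (q w)) w \<le> L * (C + C)" using q_inv[OF qw] w by (intro lower_mono) auto
  then have "dG (g \<otimes>\<^bsub>G\<^esub> q_inv (q w)) (q_inv h) \<le> L * (C + C)"
    using G.dist_left[of g "q_inv (q w)" w] w q_inv[OF qw] g by simp
  then have "dH (q (g \<otimes>\<^bsub>G\<^esub> q_inv (q w))) (q (q_inv h)) \<le> L * (L * (C + C)) + C"
    using c q_inv[OF h] by (intro upper_mono) auto
  moreover have "dH (q (g \<otimes>\<^bsub>G\<^esub> q_inv (q w))) h \<le> dH (q (g \<otimes>\<^bsub>G\<^esub> q_inv (q w))) (q (q_inv h)) + dH (q (q_inv h)) h"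
    using c q_inv[OF h] h q_closed by (intro H.dist_triangle) auto
  ultimately have "dH (q (g \<otimes>\<^bsub>G\<^esub> q_inv (q w))) h \<le> L * (L * (C + C)) + C + C"
    using q_inv[OF h] by linarith
  also have "\<dots> \<le> 3 * L * L * C + 2 * C" using L_ge C_ge by (simp add: algebra_simps)
  finally show "\<exists>x\<in>carrier H. dH (q (g \<otimes>\<^bsub>G\<^esub> q_inv x)) h \<le> 3 * L * L * C + 2 * C" using qw by blast
qed

lemma translate_close:
  assumes g: "g \<in> carrier G" and V: "V \<subseteq> carrier H" "V' \<subseteq> carrier H"
    and close: "close_sets dH M ((\<lambda>h. q (g \<otimes>\<^bsub>G\<^esub> q_inv h)) ` V) V'"
  shows "close_sets dG (L * ((M + C) + C)) (g <#\<^bsub>G\<^esub> q_inv ` V) (q_inv ` V')"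
proof (rule close_of_close_images)
  show "g <#\<^bsub>G\<^esub> q_inv ` V \<subseteq> carrier G" "q_inv ` V' \<subseteq> carrier G"
    using V g q_inv by (auto simp: l_coset_def subset_iff)
  have im: "q ` (g <#\<^bsub>G\<^esub> q_inv ` V) = (\<lambda>h. q (g \<otimes>\<^bsub>G\<^esub> q_inv h)) ` V" by (auto simp: l_coset_def)
  have l: "dH (q (g \<otimes>\<^bsub>G\<^esub> q_inv v)) (q (q_inv v')) \<le> M + C" if "v \<in> V" "v' \<in> V'" "dH (q (g \<otimes>\<^bsub>G\<^esub> q_inv v)) v' \<le> M" for v v'
    using that V g q_inv q_closed by (intro q_q_inv_close) auto
  show "close_sets dH (M + C) (q ` (g <#\<^bsub>G\<^esub> q_inv ` V)) (q ` q_inv ` V')"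
    unfolding im close_sets_def
  proof (intro conjI ballI; (elim imageE)?)
    fix x v assume v: "v \<in> V" and x: "x = q (g \<otimes>\<^bsub>G\<^esub> q_inv v)"
    then obtain v' where "v' \<in> V'" "dH x v' \<le> M" using close unfolding close_sets_def by blast
    then show "\<exists>y\<in>q ` q_inv ` V'. dH x y \<le> M + C" using l v x by blast
  next
    fix y z v' assume v': "v' \<in> V'" and y: "y = q z" "z = q_inv v'"
    then obtain v where "v \<in> V" "dH (q (g \<otimes>\<^bsub>G\<^esub> q_inv v)) v' \<le> M" using close unfolding close_sets_def by blast
    then show "\<exists>x\<in>(\<lambda>h. q (g \<otimes>\<^bsub>G\<^esub> q_inv h)) ` V. dH x y \<le> M + C" using l v' y by blast
  qed
qed

end

section \<open>Cosets\<close>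

lemma (in group) all_lcosets_iff:
  "W \<in> all_lcosets G \<P> \<longleftrightarrow> (\<exists>P\<in>\<P>. \<exists>g\<in>carrier G. W = g <# P)"
  unfolding all_lcosets_def LCOSETS_def by auto

lemma (in group) all_lcosets_subset:
  assumes "\<forall>P\<in>\<P>. subgroup P G" "W \<in> all_lcosets G \<P>"
  shows "W \<subseteq> carrier G" "W \<noteq> {}"
proof -
  obtain P g where P: "P \<in> \<P>" "g \<in> carrier G" "W = g <# P" using assms unfolding all_lcosets_iff by auto
  then have "subgroup P G" using assms by blast
  then show "W \<subseteq> carrier G" "W \<noteq> {}"
    using P l_coset_subset_G[OF subgroup.subset] subgroup.one_closed[of P G] by (auto simp: l_coset_def)
qed

lemma (in group) finite_lcosets_meeting:
  assumes "finite \<P>" "\<forall>P\<in>\<P>. subgroup P G" "finite F"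
  shows "finite {W \<in> all_lcosets G \<P>. W \<inter> F \<noteq> {}}"
proof (rule finite_subset)
  show "{W \<in> all_lcosets G \<P>. W \<inter> F \<noteq> {}} \<subseteq> (\<lambda>(g, P). g <# P) ` (F \<times> \<P>)"
  proof
    fix W assume W: "W \<in> {W \<in> all_lcosets G \<P>. W \<inter> F \<noteq> {}}"
    then obtain P g x where P: "P \<in> \<P>" "g \<in> carrier G" "W = g <# P" "x \<in> W" "x \<in> F"
      unfolding all_lcosets_iff by auto
    then have "x <# P = W" using l_repr_independence[of x g P] assms(2) by auto
    then show "W \<in> (\<lambda>(g, P). g <# P) ` (F \<times> \<P>)" using P by (intro image_eqI[of _ _ "(x, P)"]) auto
  qed
qed (use assms in auto)

text \<open>Every subgroup of a finite group has finite index, so a finite subgroup is commensurated by the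
  whole group, in which it then has finite index.\<close>

lemma (in group) finite_carrier_if_finite_peripheral:
  assumes P: "subgroup P G" "finite P" and idx: "finite_index G P (commensurator G P)"
  shows "finite (carrier G)"
proof -
  have fin: "finite (rcosets\<^bsub>G\<lparr>carrier := X\<rparr>\<^esub> K)" if "finite X" for X K
    using that unfolding RCOSETS_def by auto
  have "finite ((g <# P) #> inv g)" for g
    using P by (simp add: l_coset_def r_coset_def)
  then have "commensurator G P = carrier G"
    unfolding commensurator_def finite_index_def Let_def using fin P by auto
  then have "finite (rcosets P)" using idx unfolding finite_index_def by simp
  moreover have "finite W" if "W \<in> rcosets P" for W
    using that P by (auto simp: RCOSETS_def r_coset_def)
  ultimately have "finite (\<Union>(rcosets P))" by blast
  moreover have "carrier G \<subseteq> \<Union>(rcosets P)"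
    using rcosets_part_G[OF P(1)] by simp
  ultimately show ?thesis using finite_subset by blast
qed

section \<open>The collection of coarse stabilisers\<close>

text \<open>If \<open>H\<close> is infinite, then elements of \<open>H/\<Q>\<close> at finite Hausdorff distance are equal by \<open>sep\<close>; if \<open>H\<close>
  is finite, then all distances are bounded by a constant \<open>K\<close>. In both cases the last axiom of
  \<open>coarsely_permuted\<close> holds.\<close>

lemma (in group_quasi_isometry) coarsely_permuted_cosets:
  assumes fin: "finite B" "finite \<Q>" and sub: "\<forall>Q\<in>\<Q>. subgroup Q H"
    and char: "qi_characteristic H B \<Q>"
    and sep: "\<And>V V' r. \<lbrakk>V \<in> all_lcosets H \<Q>; V' \<in> all_lcosets H \<Q>; close_sets dH r V V'; infinite (carrier H)\<rbrakk> \<Longrightarrow> V = V'"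
  shows "\<exists>M. coarsely_permuted G A ((`) q_inv ` all_lcosets H \<Q>) M"
proof -
  note cos = H.all_lcosets_subset[OF sub]
  have "\<forall>L\<ge>1. \<forall>C\<ge>0. \<exists>M\<ge>0. \<forall>f. quasi_isometry_with L C (carrier H) dH (carrier H) dH f \<longrightarrow> qi_pairs_with L C M H B \<Q> H B \<Q> f"
    using char unfolding qi_characteristic_def by blast
  moreover have "L * L \<ge> 1" "3 * L * L * C + 2 * C \<ge> 0"
    using conjugated_translation_qi[OF G.one_closed] unfolding quasi_isometry_with_def by auto
  ultimately obtain M where "M \<ge> 0"
    and M: "\<And>f. quasi_isometry_with (L * L) (3 * L * L * C + 2 * C) (carrier H) dH (carrier H) dH f \<Longrightarrow>
      qi_pairs_with (L * L) (3 * L * L * C + 2 * C) M H B \<Q> H B \<Q> f" by meson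
  have perm: "\<exists>V'\<in>all_lcosets H \<Q>. close_sets dG (L * ((M + C) + C)) (g <#\<^bsub>G\<^esub> q_inv ` V) (q_inv ` V')"
    if g: "g \<in> carrier G" and V: "V \<in> all_lcosets H \<Q>" for g V
  proof -
    let ?f = "\<lambda>h. q (g \<otimes>\<^bsub>G\<^esub> q_inv h)"
    have "V \<in> fst ` coset_relation H \<Q> H B \<Q> M ?f"
      using M[OF conjugated_translation_qi[OF g]] V unfolding qi_pairs_with_def by blast
    then obtain V' where V': "V' \<in> all_lcosets H \<Q>" "hausdorff_dist dH (?f ` V) V' < ereal M"
      unfolding coset_relation_def by auto
    then show ?thesis
      using translate_close[OF g cos(1)[OF V] cos(1)[OF V'(1)] close_setsI_hausdorff] by blast
  qed
  obtain K where K: "finite (carrier H) \<Longrightarrow> g \<in> carrier H \<Longrightarrow> h \<in> carrier H \<Longrightarrow> dH g h \<le> K" for g h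
  proof (cases "finite (carrier H)")
    case True
    then have "finite ((\<lambda>(g, h). dH g h) ` (carrier H \<times> carrier H))" by simp
    then have "\<exists>K. \<forall>x\<in>(\<lambda>(g, h). dH g h) ` (carrier H \<times> carrier H). x \<le> K"
      by (intro exI[of _ "Max ((\<lambda>(g, h). dH g h) ` (carrier H \<times> carrier H))"]) auto
    then show ?thesis using that by auto
  qed (use that in blast)
  define M' where "M' = max (max (L * ((M + C) + C)) (L * (K + 3 * C))) 0"
  have "coarsely_permuted G A ((`) q_inv ` all_lcosets H \<Q>) M'"
  proof (unfold_locales)
    show "U \<subseteq> carrier G" if U: "U \<in> (`) q_inv ` all_lcosets H \<Q>" for U
      using U cos(1) q_inv_closed by (auto simp: subset_iff)
    show "U \<noteq> {}" if U: "U \<in> (`) q_inv ` all_lcosets H \<Q>" for U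
      using U cos(2) by auto
    show "\<exists>V\<in>(`) q_inv ` all_lcosets H \<Q>. close_sets dG M' (g <#\<^bsub>G\<^esub> U) V"
      if g: "g \<in> carrier G" and U: "U \<in> (`) q_inv ` all_lcosets H \<Q>" for g U
    proof -
      obtain V where V: "V \<in> all_lcosets H \<Q>" "U = q_inv ` V" using U by blast
      then obtain V' where V': "V' \<in> all_lcosets H \<Q>"
        "close_sets dG (L * ((M + C) + C)) (g <#\<^bsub>G\<^esub> U) (q_inv ` V')" using perm[OF g] by blast
      have "close_sets dG M' (g <#\<^bsub>G\<^esub> U) (q_inv ` V')"
        using V'(2) by (rule close_sets_mono) (simp add: M'_def)
      then show ?thesis using V' by blast
    qed
    show "finite {U \<in> (`) q_inv ` all_lcosets H \<Q>. \<exists>u\<in>U. dG \<one>\<^bsub>G\<^esub> u \<le> r}" for r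
    proof -
      let ?F = "{h \<in> carrier H. dH (q \<one>\<^bsub>G\<^esub>) h \<le> (L * r + C) + C}"
      have fin_meet: "finite {V \<in> all_lcosets H \<Q>. V \<inter> ?F \<noteq> {}}"
        using fin sub H.finite_ball[OF fin(1)] q_closed by (intro H.finite_lcosets_meeting) auto
      have meet: "V \<inter> ?F \<noteq> {}" if V: "V \<in> all_lcosets H \<Q>" and v: "v \<in> V" "dG \<one>\<^bsub>G\<^esub> (q_inv v) \<le> r" for V v
      proof -
        have vc: "v \<in> carrier H" using V v cos by blast
        have "dH (q \<one>\<^bsub>G\<^esub>) v \<le> dH (q \<one>\<^bsub>G\<^esub>) (q (q_inv v)) + dH (q (q_inv v)) v"
          using q_closed q_inv[OF vc] vc by (intro H.dist_triangle) auto
        moreover have "dH (q \<one>\<^bsub>G\<^esub>) (q (q_inv v)) \<le> L * r + C" using q_inv[OF vc] v by (intro upper_mono) auto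
        ultimately have "dH (q \<one>\<^bsub>G\<^esub>) v \<le> (L * r + C) + C" using q_inv[OF vc] by linarith
        then show ?thesis using v vc by blast
      qed
      have "{U \<in> (`) q_inv ` all_lcosets H \<Q>. \<exists>u\<in>U. dG \<one>\<^bsub>G\<^esub> u \<le> r} \<subseteq>
          (`) q_inv ` {V \<in> all_lcosets H \<Q>. V \<inter> ?F \<noteq> {}}"
      proof
        fix U assume "U \<in> {U \<in> (`) q_inv ` all_lcosets H \<Q>. \<exists>u\<in>U. dG \<one>\<^bsub>G\<^esub> u \<le> r}"
        then obtain V v where V: "V \<in> all_lcosets H \<Q>" "U = q_inv ` V" "v \<in> V" "dG \<one>\<^bsub>G\<^esub> (q_inv v) \<le> r"
          by blast
        from V(2) show "U \<in> (`) q_inv ` {V \<in> all_lcosets H \<Q>. V \<inter> ?F \<noteq> {}}"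
          by (rule image_eqI) (use V(1) meet[OF V(1,3,4)] in blast)
      qed
      then show ?thesis by (rule finite_surj[OF fin_meet])
    qed
    show "close_sets dG M' U U'"
      if U: "U \<in> (`) q_inv ` all_lcosets H \<Q>" "U' \<in> (`) q_inv ` all_lcosets H \<Q>" "close_sets dG r U U'" for U U' r
    proof -
      obtain V V' where V: "V \<in> all_lcosets H \<Q>" "V' \<in> all_lcosets H \<Q>" "U = q_inv ` V" "U' = q_inv ` V'"
        using U by blast
      have UG: "U \<subseteq> carrier G" "U \<noteq> {}" "U' \<noteq> {}"
        unfolding V(3,4) using cos[OF V(1)] cos[OF V(2)] q_inv_closed by blast+
      show ?thesis
      proof (cases "finite (carrier H)")
        case True
        have "dG (q_inv v) (q_inv v') \<le> M'" if "v \<in> carrier H" "v' \<in> carrier H" for v v'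
        proof -
          have "L * (dH v v' + 3 * C) \<le> L * (K + 3 * C)"
            using K[OF True that] L_ge by (intro mult_left_mono) auto
          then show ?thesis using dist_q_inv(1)[OF that] unfolding M'_def by linarith
        qed
        then have "dG u u' \<le> M'" if "u \<in> U" "u' \<in> U'" for u u'
          using that V cos(1) by blast
        then show ?thesis using UG(2,3) unfolding close_sets_def by blast
      next
        case False
        have "close_sets dH (L * r + 3 * C) V V'"
          using U(3) V cos(1) by (intro close_of_close_q_inv) auto
        then have "V = V'" using sep V False by blast
        then show ?thesis using V G.close_refl[OF UG(1), of M'] by (simp add: M'_def)
      qed
    qed
  qed
  then show ?thesis by blast
qed

lemma (in group_quasi_isometry) ex_paired_collection:
  assumes "coarsely_permuted G A ((`) q_inv ` all_lcosets H \<Q>) M" and sub: "\<forall>Q\<in>\<Q>. subgroup Q H"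
  shows "\<exists>\<P> R. finite \<P> \<and> (\<forall>P\<in>\<P>. subgroup P G) \<and>
     (\<forall>W\<in>all_lcosets G \<P>. \<exists>V\<in>all_lcosets H \<Q>. close_sets dH R (q ` W) V) \<and>
     (\<forall>V\<in>all_lcosets H \<Q>. \<exists>W\<in>all_lcosets G \<P>. close_sets dH R (q ` W) V) \<and>
     (\<forall>W\<in>all_lcosets G \<P>. \<forall>W'\<in>all_lcosets G \<P>. \<forall>r. close_sets dG r W W' \<longrightarrow> W = W')"
proof -
  interpret U: coarsely_permuted G A "(`) q_inv ` all_lcosets H \<Q>" M by fact
  obtain \<P> D where P: "finite \<P>" "\<forall>P\<in>\<P>. subgroup P G"
     and 1: "\<forall>W\<in>all_lcosets G \<P>. \<exists>U\<in>(`) q_inv ` all_lcosets H \<Q>. close_sets dG D W U"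
     and 2: "\<forall>U\<in>(`) q_inv ` all_lcosets H \<Q>. \<exists>W\<in>all_lcosets G \<P>. close_sets dG D W U"
     and 3: "\<forall>W\<in>all_lcosets G \<P>. \<forall>W'\<in>all_lcosets G \<P>. \<forall>r. close_sets dG r W W' \<longrightarrow> W = W'"
    using U.ex_stabiliser_collection by (elim exE conjE) (rule that)
  have c: "close_sets dH (L * D + C + C) (q ` W) V"
    if "W \<in> all_lcosets G \<P>" "V \<in> all_lcosets H \<Q>" "close_sets dG D W (q_inv ` V)" for W V
    using that G.all_lcosets_subset[OF P(2)] H.all_lcosets_subset[OF sub] by (intro close_image_q) auto
  have "\<exists>V\<in>all_lcosets H \<Q>. close_sets dH (L * D + C + C) (q ` W) V" if "W \<in> all_lcosets G \<P>" for W
    using 1 c that by blast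
  moreover have "\<exists>W\<in>all_lcosets G \<P>. close_sets dH (L * D + C + C) (q ` W) V" if "V \<in> all_lcosets H \<Q>" for V
    using 2 c that by blast
  ultimately show ?thesis using P 3
    by (intro exI[of _ \<P>] exI[of _ "L * D + C + C"]) auto
qed

section \<open>Transfer of hyperbolic embeddings\<close>

text \<open>Distances with respect to \<open>B\<close> control those with respect to \<open>T\<close>, and \<open>q\<close> relates the latter
  to \<open>S\<close>; hence points that are close in \<open>H\<close> for the finite generating set come from points of \<open>G\<close>
  that are close with respect to \<open>S\<close>, although \<open>S\<close> may be infinite. The assumption \<open>sep\<close> makes the
  correspondence of cosets injective, as fineness requires: if two cosets of \<open>G\<close> had the same
  partner, then the cone vertex of one would be mapped to the cone vertex that is to be
  avoided for the other.\<close>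

lemma hyp_embedded_pullback:
  assumes AB: "group_quasi_isometry G A H B q L C" and ST: "group_quasi_isometry G S H T q L' C'"
    and fin: "finite A" "finite B"
    and P: "\<forall>P\<in>\<P>. subgroup P G" and Q: "\<forall>Q\<in>\<Q>. subgroup Q H"
    and PQ: "\<forall>W\<in>all_lcosets G \<P>. \<exists>V\<in>all_lcosets H \<Q>. close_sets (word_dist H B) R (q ` W) V"
    and QP: "\<forall>V\<in>all_lcosets H \<Q>. \<exists>W\<in>all_lcosets G \<P>. close_sets (word_dist H B) R (q ` W) V"
    and sep: "\<And>W W' r. \<lbrakk>W \<in> all_lcosets G \<P>; W' \<in> all_lcosets G \<P>; close_sets (word_dist G A) r W W'\<rbrakk> \<Longrightarrow> W = W'"
    and hyp: "hyp_embedded \<Q> H T"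
  shows "hyp_embedded \<P> G S"
proof -
  interpret group_quasi_isometry G A H B q L C by fact
  interpret ST: group_quasi_isometry G S H T q L' C' by fact
  define \<C> where "\<C> = all_lcosets G \<P>"
  define \<D> where "\<D> = all_lcosets H \<Q>"
  have sC: "W \<subseteq> carrier G" "W \<noteq> {}" if "W \<in> \<C>" for W
    using G.all_lcosets_subset[OF P] that unfolding \<C>_def by blast+
  have sD: "V \<subseteq> carrier H" "V \<noteq> {}" if "V \<in> \<D>" for V
    using H.all_lcosets_subset[OF Q] that unfolding \<D>_def by blast+
  obtain \<phi> where \<phi>: "\<And>W. W \<in> \<C> \<Longrightarrow> \<phi> W \<in> \<D>" "\<And>W. W \<in> \<C> \<Longrightarrow> close_sets dH R (q ` W) (\<phi> W)"
    using PQ unfolding \<C>_def \<D>_def by metis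
  obtain \<chi> where \<chi>: "\<And>V. V \<in> \<D> \<Longrightarrow> \<chi> V \<in> \<C>" "\<And>V. V \<in> \<D> \<Longrightarrow> close_sets dH R (q ` \<chi> V) V"
    using QP unfolding \<C>_def \<D>_def by metis
  have inj: "inj_on \<phi> \<C>"
  proof (rule inj_onI)
    fix W W' assume W: "W \<in> \<C>" "W' \<in> \<C>" "\<phi> W = \<phi> W'"
    have qW: "q ` W \<subseteq> carrier H" "q ` W' \<subseteq> carrier H" "\<phi> W' \<subseteq> carrier H"
      using sC W q_closed sD[OF \<phi>(1)] by blast+
    have "close_sets dH R (\<phi> W') (q ` W')" using H.close_sym[OF qW(2,3)] \<phi>(2) W by blast
    then have "close_sets dH (R + R) (q ` W) (q ` W')"
      using H.close_trans[OF qW(1,3,2)] \<phi>(2)[OF W(1)] W(3) by metis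
    then have "close_sets dG (L * ((R + R) + C)) W W'" using close_of_close_images sC W by blast
    then show "W = W'" using sep W unfolding \<C>_def by blast
  qed
  obtain c :: nat where c: "\<And>g h. g \<in> carrier H \<Longrightarrow> h \<in> carrier H \<Longrightarrow> word_dist H T g h \<le> real c * dH g h"
    using ST.H.dist_le_finite_generating[OF fin(2)] H.gen by blast
  have c_mono: "word_dist H T g h \<le> real c * r" if "g \<in> carrier H" "h \<in> carrier H" "dH g h \<le> r" for g h r
    using c[OF that(1,2)] mult_left_mono[OF that(3), of "real c"] by linarith
  have low: "word_dist G S x y \<le> L' * (real c * r + C')"
    if "x \<in> carrier G" "y \<in> carrier G" "dH (q x) (q y) \<le> r" for x y r
    using that q_closed by (intro ST.lower_mono c_mono) auto
  \<comment> \<open>One constant for all bounds: \<open>q\<close> on edges and from cosets to their partners, \<open>q_inv\<close> likewise,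
    and the distance of the composition from the identity on elements and on cosets.\<close>
  define m where "m = max (max (L' + C') (real c * R))
     (max (max (L' * ((real c * C + 1 + real c * C) + C')) (L' * (real c * (C + R) + C')))
       (max (L' * (real c * C + C')) (L' * (real c * (R + R) + C'))))"
  define N where "N = nat \<lceil>m\<rceil>"
  have "m \<le> real N" unfolding N_def by (rule real_nat_ceiling_ge)
  then have N: "L' + C' \<le> N" "real c * R \<le> N" "L' * ((real c * C + 1 + real c * C) + C') \<le> N"
    "L' * (real c * (C + R) + C') \<le> N" "L' * (real c * C + C') \<le> N" "L' * (real c * (R + R) + C') \<le> N"
    unfolding m_def max.bounded_iff by blast+
  have near: "\<exists>v\<in>\<phi> W. dH (q x) v \<le> R" if "W \<in> \<C>" "x \<in> W" for W x
    using \<phi>(2)[OF that(1)] that(2) unfolding close_sets_def by blast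
  have step: "word_dist G S x (x \<otimes>\<^bsub>G\<^esub> s) \<le> 1" if "x \<in> carrier G" "s \<in> S" for x s
    using ST.G.dist_generator that by blast
  have step': "word_dist H T x (x \<otimes>\<^bsub>H\<^esub> s) \<le> 1" if "x \<in> carrier H" "s \<in> T" for x s
    using ST.H.dist_generator that by blast
  have F: "cone_map G S H T \<C> \<D> q \<phi> N"
  proof
    show "word_dist H T (q g) (q (g \<otimes>\<^bsub>G\<^esub> s)) \<le> N" if "g \<in> carrier G" "s \<in> S" for g s
      using ST.upper_mono[OF _ _ step[OF that]] that ST.G.S_subset N(1) by fastforce
    show "\<exists>v\<in>\<phi> U. word_dist H T (q x) v \<le> N" if U: "U \<in> \<C>" "x \<in> U" for U x
    proof -
      obtain v where v: "v \<in> \<phi> U" "dH (q x) v \<le> R" using near[OF U] by blast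
      have "q x \<in> carrier H" "v \<in> carrier H" using v U sC sD \<phi>(1) q_closed by blast+
      then show ?thesis using v c_mono[of "q x" v R] N(2) by force
    qed
  qed (use q_closed \<phi> sC sD in auto)
  have B: "cone_map H T G S \<D> \<C> q_inv \<chi> N"
  proof
    show "word_dist G S (q_inv g) (q_inv (g \<otimes>\<^bsub>H\<^esub> s)) \<le> N" if g: "g \<in> carrier H" "s \<in> T" for g s
    proof -
      have gs: "g \<otimes>\<^bsub>H\<^esub> s \<in> carrier H" using g ST.H.S_subset by auto
      note pc = q_inv[OF g(1)] q_inv[OF gs]
      have qc: "q (q_inv g) \<in> carrier H" "q (q_inv (g \<otimes>\<^bsub>H\<^esub> s)) \<in> carrier H" using pc q_closed by auto
      have "word_dist H T (q (q_inv g)) (q (q_inv (g \<otimes>\<^bsub>H\<^esub> s))) \<le> word_dist H T (q (q_inv g)) g + word_dist H T g (q (q_inv (g \<otimes>\<^bsub>H\<^esub> s)))"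
        "word_dist H T g (q (q_inv (g \<otimes>\<^bsub>H\<^esub> s))) \<le> word_dist H T g (g \<otimes>\<^bsub>H\<^esub> s) + word_dist H T (g \<otimes>\<^bsub>H\<^esub> s) (q (q_inv (g \<otimes>\<^bsub>H\<^esub> s)))"
        using qc g gs by (auto intro!: ST.H.dist_triangle)
      moreover have "word_dist H T (q (q_inv g)) g \<le> real c * C" "word_dist H T (q (q_inv (g \<otimes>\<^bsub>H\<^esub> s))) (g \<otimes>\<^bsub>H\<^esub> s) \<le> real c * C"
        using pc qc g gs by (auto intro!: c_mono)
      moreover note ST.H.dist_sym[OF qc(2) gs] step'[OF g]
      ultimately have "word_dist H T (q (q_inv g)) (q (q_inv (g \<otimes>\<^bsub>H\<^esub> s))) \<le> real c * C + 1 + real c * C" by linarith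
      then show ?thesis using ST.lower_mono[OF pc(1,3)] N(3) by force
    qed
    show "\<exists>x\<in>\<chi> V. word_dist G S (q_inv h) x \<le> N" if V: "V \<in> \<D>" "h \<in> V" for V h
    proof -
      have h: "h \<in> carrier H" using V sD by blast
      obtain x where x: "x \<in> \<chi> V" "dH (q x) h \<le> R" using \<chi>(2)[OF V(1)] V(2) unfolding close_sets_def by blast
      have xc: "x \<in> carrier G" using x V \<chi>(1) sC by blast
      have "dH (q (q_inv h)) (q x) \<le> dH (q (q_inv h)) h + dH h (q x)" "dH h (q x) = dH (q x) h"
        using q_inv[OF h] xc q_closed h by (auto intro!: H.dist_triangle H.dist_sym)
      then have "dH (q (q_inv h)) (q x) \<le> C + R" using q_inv[OF h] x by linarith
      then have "word_dist G S (q_inv h) x \<le> N" using low[OF q_inv_closed[OF h] xc] N(4) by force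
      then show ?thesis using x by blast
    qed
  qed (use q_inv_closed \<chi> sC sD in auto)
  have hyp': "hyperbolic_graph (cone_graph H T \<D>)" "\<And>V. V \<in> \<D> \<Longrightarrow> fine_at (cone_graph H T \<D>) (Inr V)"
    using hyp unfolding hyp_embedded_def coned_off_cayley_graph_eq \<D>_def by auto
  have "hyperbolic_graph (cone_graph G S \<C>)"
  proof (rule hyperbolic_cone_graph_pullback[OF F B])
    show "word_dist G S (q_inv (q g)) g \<le> N" if "g \<in> carrier G" for g
      using low[OF q_inv_closed[OF q_closed[OF that]] that q_q_inv[OF q_closed[OF that]]] N(5) by linarith
    show "\<exists>x\<in>\<chi> (\<phi> W). \<exists>y\<in>W. word_dist G S x y \<le> N" if W: "W \<in> \<C>" for W
    proof -
      obtain y where y: "y \<in> W" using sC[OF W] by blast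
      obtain v where v: "v \<in> \<phi> W" "dH (q y) v \<le> R" using near[OF W y] by blast
      obtain x where x: "x \<in> \<chi> (\<phi> W)" "dH (q x) v \<le> R"
        using \<chi>(2)[OF \<phi>(1)[OF W]] v unfolding close_sets_def by blast
      have cc: "x \<in> carrier G" "y \<in> carrier G" "v \<in> carrier H"
        using x y v W sC sD \<phi>(1) \<chi>(1) by blast+
      have "dH (q x) (q y) \<le> dH (q x) v + dH v (q y)" "dH v (q y) = dH (q y) v"
        using cc q_closed by (auto intro!: H.dist_triangle H.dist_sym)
      then have "dH (q x) (q y) \<le> R + R" using x v by linarith
      then have "word_dist G S x y \<le> N" using low[OF cc(1,2)] N(6) by force
      then show ?thesis using x y by blast
    qed
  qed (use sC sD hyp' in auto)
  moreover have "fine_at (cone_graph G S \<C>) (Inr W)" if W: "W \<in> \<C>" for W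
  proof -
    obtain k where k: "\<And>x. x \<in> W \<Longrightarrow> k x \<in> \<phi> W" "\<And>x. x \<in> W \<Longrightarrow> dH (q x) (k x) \<le> R"
      using near[OF W] by metis
    have Wc: "x \<in> carrier G" "k x \<in> carrier H" if "x \<in> W" for x
      using that sC[OF W] sD[OF \<phi>(1)[OF W]] k(1) by blast+
    show ?thesis
    proof (rule cone_map.fine_at_pullback[OF F W inj hyp'(2)[OF \<phi>(1)[OF W]]])
      show "k x \<in> \<phi> W \<and> word_dist H T (q x) (k x) \<le> N" if x: "x \<in> W" for x
        using k[OF x] c_mono[OF q_closed[OF Wc(1)[OF x]] Wc(2)[OF x] k(2)[OF x]] N(2) by simp
      show "finite {x \<in> W. k x = v}" for v
      proof (cases "v \<in> carrier H")
        case True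
        have "{x \<in> W. k x = v} \<subseteq> {x \<in> carrier G. dH (q x) v \<le> R}" using k Wc by auto
        then show ?thesis using finite_preimage_ball[OF fin(1) True] finite_subset by blast
      next
        case False
        then have "{x \<in> W. k x = v} = {}" using Wc by auto
        then show ?thesis by (simp only: finite.emptyI)
      qed
    qed
  qed
  moreover have "connected_graph (cone_graph G S \<C>)"
    using ST.G.connected_cone_graph sC by blast
  ultimately show ?thesis
    unfolding hyp_embedded_def coned_off_cayley_graph_eq \<C>_def[symmetric] by blast
qed

text \<open>By \<open>fine_cone_separated\<close> the coset \<open>V\<close> would be finite, and so would be \<open>H\<close> by
  \<open>finite_carrier_if_finite_peripheral\<close>.\<close>

lemma cosets_separated:
  assumes "group H" and B: "finite B" "generating_set H B" and T: "generating_set H T"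
    and Q: "\<forall>Q\<in>\<Q>. subgroup Q H" and char: "qi_characteristic H B \<Q>" and hyp: "hyp_embedded \<Q> H T"
    and V: "V \<in> all_lcosets H \<Q>" "V' \<in> all_lcosets H \<Q>" "close_sets (word_dist H B) r V V'"
    and inf: "infinite (carrier H)"
  shows "V = V'"
proof (rule ccontr)
  assume "V \<noteq> V'"
  interpret B: word_metric H B using assms by (simp add: word_metric_def word_metric_axioms_def)
  interpret T: word_metric H T using assms by (simp add: word_metric_def word_metric_axioms_def)
  obtain c :: nat where c: "\<And>g h. g \<in> carrier H \<Longrightarrow> h \<in> carrier H \<Longrightarrow> word_dist H T g h \<le> real c * word_dist H B g h"
    using T.dist_le_finite_generating[OF B] by blast
  note s = B.all_lcosets_subset[OF Q]
  have "finite V"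
  proof (rule T.fine_cone_separated)
    show "fine_at (cone_graph H T (all_lcosets H \<Q>)) (Inr V)"
      using hyp V unfolding hyp_embedded_def coned_off_cayley_graph_eq by blast
    show "\<exists>v'\<in>V'. word_dist H T v v' \<le> real c * r" if v: "v \<in> V" for v
    proof -
      obtain v' where v': "v' \<in> V'" "word_dist H B v v' \<le> r" using V(3) v unfolding close_sets_def by blast
      have "word_dist H T v v' \<le> real c * word_dist H B v v'" using v v' V s by (intro c) blast+
      also have "\<dots> \<le> real c * r" using v' by (intro mult_left_mono) auto
      finally show ?thesis using v' by blast
    qed
  qed (use V \<open>V \<noteq> V'\<close> s in auto)
  obtain Q g where Qg: "Q \<in> \<Q>" "g \<in> carrier H" "V = g <#\<^bsub>H\<^esub> Q"
    using V(1) unfolding B.all_lcosets_iff by blast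
  then have "subgroup Q H" using Q by blast
  have "Q \<subseteq> (\<lambda>v. inv\<^bsub>H\<^esub> g \<otimes>\<^bsub>H\<^esub> v) ` V"
  proof
    fix x assume x: "x \<in> Q"
    then have "x \<in> carrier H" using subgroup.subset[OF \<open>subgroup Q H\<close>] by blast
    then have "x = inv\<^bsub>H\<^esub> g \<otimes>\<^bsub>H\<^esub> (g \<otimes>\<^bsub>H\<^esub> x)"
      using Qg by (simp add: B.m_assoc[symmetric])
    moreover have "g \<otimes>\<^bsub>H\<^esub> x \<in> V" using x Qg unfolding l_coset_def by blast
    ultimately show "x \<in> (\<lambda>v. inv\<^bsub>H\<^esub> g \<otimes>\<^bsub>H\<^esub> v) ` V" by (rule image_eqI)
  qed
  then have "finite Q" using \<open>finite V\<close> finite_surj by blast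
  moreover have "finite_index H Q (commensurator H Q)"
    using char Qg unfolding qi_characteristic_def by blast
  ultimately show False
    using B.finite_carrier_if_finite_peripheral[OF \<open>subgroup Q H\<close>] inf by blast
qed

theorem corollaryB:
  fixes G :: "('a, 'm) monoid_scheme" and H :: "('b, 'n) monoid_scheme"
    and A S :: "'a set" and B T :: "'b set"
    and \<Q> :: "'b set set" and q :: "'a \<Rightarrow> 'b"
  assumes "group G" and "group H"
    and "finite A" and "generating_set G A"
    and "finite B" and "generating_set H B"
    and "generating_set H T"
    and "finite \<Q>" and "\<forall>Q\<in>\<Q>. subgroup Q H"
    and "hyp_embedded \<Q> H T"
    and "quasi_isometry (carrier G) (word_dist G A) (carrier H) (word_dist H B) q"
    and "qi_characteristic H B \<Q>"
    and "generating_set G S"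
    and "quasi_isometry (carrier G) (word_dist G S) (carrier H) (word_dist H T) q"
  shows "\<exists>\<P>. finite \<P> \<and> (\<forall>P\<in>\<P>. subgroup P G) \<and> hyp_embedded \<P> G S \<and>
           qi_pairs G A \<P> H B \<Q> q"
proof -
  obtain L C where AB: "quasi_isometry_with L C (carrier G) (word_dist G A) (carrier H) (word_dist H B) q"
    using assms(11) unfolding quasi_isometry_def by blast
  obtain L' C' where ST: "quasi_isometry_with L' C' (carrier G) (word_dist G S) (carrier H) (word_dist H T) q"
    using assms(14) unfolding quasi_isometry_def by blast
  interpret group_quasi_isometry G A H B q L C
    using assms AB by (simp add: group_quasi_isometry_def group_quasi_isometry_axioms_def word_metric_def word_metric_axioms_def)
  have ST': "group_quasi_isometry G S H T q L' C'"
    using assms ST by (simp add: group_quasi_isometry_def group_quasi_isometry_axioms_def word_metric_def word_metric_axioms_def)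
  obtain M where "coarsely_permuted G A ((`) q_inv ` all_lcosets H \<Q>) M"
    using coarsely_permuted_cosets[OF assms(5,8,9,12)] cosets_separated[OF assms(2,5,6,7,9,12,10)] by metis
  from ex_paired_collection[OF this assms(9)] obtain \<P> R where
    P: "finite \<P>" "\<forall>P\<in>\<P>. subgroup P G"
     and PQ: "\<forall>W\<in>all_lcosets G \<P>. \<exists>V\<in>all_lcosets H \<Q>. close_sets dH R (q ` W) V"
     and QP: "\<forall>V\<in>all_lcosets H \<Q>. \<exists>W\<in>all_lcosets G \<P>. close_sets dH R (q ` W) V"
     and sep: "\<forall>W\<in>all_lcosets G \<P>. \<forall>W'\<in>all_lcosets G \<P>. \<forall>r. close_sets dG r W W' \<longrightarrow> W = W'"
    by blast
  have "hyp_embedded \<P> G S"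
    by (rule hyp_embedded_pullback[OF group_quasi_isometry_axioms ST' assms(3,5) P(2) assms(9) PQ QP _ assms(10)])
      (use sep in blast)
  moreover have "qi_pairs_with L C (max R 0 + 1) G A \<P> H B \<Q> q"
  proof -
    have rel: "(W, V) \<in> coset_relation G \<P> H B \<Q> (max R 0 + 1) q"
      if "W \<in> all_lcosets G \<P>" "V \<in> all_lcosets H \<Q>" "close_sets dH R (q ` W) V" for W V
    proof -
      have "hausdorff_dist dH (q ` W) V \<le> ereal R" using that(3) by (rule hausdorff_le_close_sets)
      also have "\<dots> < ereal (max R 0 + 1)" by simp
      finally show ?thesis using that unfolding coset_relation_def by auto
    qed
    have sub: "coset_relation G \<P> H B \<Q> (max R 0 + 1) q \<subseteq> all_lcosets G \<P> \<times> all_lcosets H \<Q>"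
      unfolding coset_relation_def by auto
    have "fst ` coset_relation G \<P> H B \<Q> (max R 0 + 1) q = all_lcosets G \<P>"
      using sub PQ rel by force
    moreover have "snd ` coset_relation G \<P> H B \<Q> (max R 0 + 1) q = all_lcosets H \<Q>"
      using sub QP rel by force
    ultimately show ?thesis unfolding qi_pairs_with_def using AB by simp
  qed
  ultimately show ?thesis using P unfolding qi_pairs_def by blast
qed

end
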